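(* (Exactness Axiom) For each closed $P$-pair $(X,A)\in\mathcal{K}^2_{Top}$, with inclusions $i:A\to X$ and $j:X\to(X,A)$, and each abelian group $G$, there is a long exact homological sequence $$\cdots\to\bar H^N_n(A;G)\xrightarrow{i_*}\bar H^N_n(X;G)\xrightarrow{j_*}\bar H^N_n(X,A;G)\xrightarrow{E}\bar H^N_{n-1}(A;G)\to\cdots,$$ where $\bar H^N_*$ is the Alexander-Spanier normal homology.
   Context: A normal covering of a space $X$ is an open covering $\alpha=\{U_\alpha\}$ admitting a partition of unity $\{\varphi_{U_\alpha}\}$ subordinated to it: continuous $\varphi_{U_\alpha}\ge 0$, $\sum\varphi_{U_\alpha}=1$, $\{x:\varphi_{U_\alpha}(x)>0\}\subset U_\alpha$. A subspace $A\subset X$ is $P$-embedded if every normal covering $\beta$ of $A$ is refined by $\alpha|_A=\{U_\alpha\cap A: U_\alpha\in\alpha\}$ for some normal covering $\alpha$ of $X$. A closed $P$-pair is a pair $(X,A)$ with $A$ closed and $P$-embedded in $X$; $\mathcal{K}^2_{Top}$ is the category of closed $P$-pairs and continuous maps of pairs. Alexander-Spanier normal cochains: let $C^n(X;\mathbb Z)$ be the group of all functions $X^{n+1}\to\mathbb Z$ with $\delta\varphi(x_0,\dots,x_{n+1})=\sum_i(-1)^i\varphi(x_0,\dots,\hat x_i,\dots,x_{n+1})$. For a normal covering $\alpha$ put $\alpha^{n+1}=\bigcup_{U\in\alpha}U^{n+1}$; $\varphi$ is $N$-locally zero if it vanishes on $\alpha^{n+1}$ for some normal covering $\alpha$ of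 $X$. Let $C^*_N(X;\mathbb Z)$ be the subcomplex of $N$-locally zero functions, $\bar C^*_N(X;\mathbb Z)=C^*(X;\mathbb Z)/C^*_N(X;\mathbb Z)$ and $\bar C^*_N(X,A;\mathbb Z)=\ker(\bar C^*_N(X;\mathbb Z)\to\bar C^*_N(A;\mathbb Z))$ (restriction, which is onto). Alexander-Spanier normal homology: fix an injective resolution $0\to G\to G'\xrightarrow{\beta}G''\to0$ of $G$. For $C^*=\bar C^*_N(X,A;\mathbb Z)$ let $\bar C^N_*(X,A;G)$ be the chain cone of $\beta_\#:\operatorname{Hom}(C^*;G')\to\operatorname{Hom}(C^*;G'')$, i.e. $\bar C^N_n=\operatorname{Hom}(C^n;G')\oplus\operatorname{Hom}(C^{n+1};G'')$ with $\partial(\varphi',\varphi'')=(\varphi'\circ\delta,\ \beta\circ\varphi'-\varphi''\circ\delta)$; $\bar H^N_n(X,A;G)$ is its $n$-th homology, and $\bar H^N_n(X;G)=\bar H^N_n(X,\emptyset;G)$. A map $f$ induces $f_*$ by precomposition with the induced cochain map. *)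

theory Defs
  imports "HOL-Analysis.Analysis" "HOL-Algebra.Exact_Sequence" "HOL-Algebra.Product_Groups"
begin

section \<open>Normal coverings and closed P-pairs\<close>

text \<open>The sum of a partition of unity is an unordered infinite sum; local finiteness is not
  required.\<close>

definition partition_of_unity ::
  "'a topology \<Rightarrow> 'a set set \<Rightarrow> ('a set \<Rightarrow> 'a \<Rightarrow> real) \<Rightarrow> bool" where
  "partition_of_unity X \<U> \<phi> \<longleftrightarrow>
     (\<forall>U\<in>\<U>. continuous_map X euclideanreal (\<phi> U) \<and>
             (\<forall>x\<in>topspace X. 0 \<le> \<phi> U x) \<and>
             {x \<in> topspace X. \<phi> U x > 0} \<subseteq> U) \<and>
     (\<forall>x\<in>topspace X. ((\<lambda>U. \<phi> U x) has_sum 1) \<U>)"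

definition normal_covering :: "'a topology \<Rightarrow> 'a set set \<Rightarrow> bool" where
  "normal_covering X \<U> \<longleftrightarrow>
     (\<forall>U\<in>\<U>. openin X U) \<and> \<Union>\<U> = topspace X \<and> (\<exists>\<phi>. partition_of_unity X \<U> \<phi>)"

text \<open>Empty members are ignored in refinements. This only matters when \<open>\<V>\<close> is the
  empty covering of the empty space; with it, the empty subspace is P-embedded
  (see \<open>P_embedded_empty\<close>), so that absolute groups are those of the pair
  with empty second member.\<close>

definition refines :: "'a set set \<Rightarrow> 'a set set \<Rightarrow> bool" where
  "refines \<U> \<V> \<longleftrightarrow> (\<forall>U\<in>\<U>. U \<noteq> {} \<longrightarrow> (\<exists>V\<in>\<V>. U \<subseteq> V))"

definition P_embedded :: "'a topology \<Rightarrow> 'a set \<Rightarrow> bool" where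
  "P_embedded X A \<longleftrightarrow> A \<subseteq> topspace X \<and>
     (\<forall>\<B>. normal_covering (subtopology X A) \<B> \<longrightarrow>
        (\<exists>\<U>. normal_covering X \<U> \<and> refines ((\<lambda>U. U \<inter> A) ` \<U>) \<B>))"

definition closed_P_pair :: "'a topology \<Rightarrow> 'a set \<Rightarrow> bool" where
  "closed_P_pair X A \<longleftrightarrow> closedin X A \<and> P_embedded X A"

lemma normal_covering_topspace: "normal_covering X {topspace X}"
  unfolding normal_covering_def partition_of_unity_def
  by (auto intro!: exI[of _ "\<lambda>U x. 1"] simp: has_sum_finite_iff)

lemma P_embedded_empty: "P_embedded X {}"
  unfolding P_embedded_def refines_def using normal_covering_topspace[of X] by auto


section \<open>Injective abelian groups and injective resolutions\<close>

text \<open>Injectivity quantifies over all monomorphisms of abelian groups, which HOL cannot do over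
  all types at once. The test groups are taken with carriers in the (infinite) type \<open>int\<close>; the
  theorem \<open>injective_group_extend\<close> (Baer's criterion) shows that the extension property then
  holds for monomorphisms of abelian groups over arbitrary types.\<close>

definition injective_group :: "('d, 'm) monoid_scheme \<Rightarrow> bool" where
  "injective_group D \<longleftrightarrow> comm_group D \<and>
     (\<forall>(A :: int monoid) (B :: int monoid) f h.
        comm_group A \<longrightarrow> comm_group B \<longrightarrow> f \<in> mon A B \<longrightarrow> h \<in> hom A D \<longrightarrow>
        (\<exists>k \<in> hom B D. \<forall>a \<in> carrier A. k (f a) = h a))"

lemma injective_group_divisible:
  assumes D: "injective_group D" and d: "d \<in> carrier D" and m: "(m::int) > 0"
  shows "\<exists>e\<in>carrier D. e [^]\<^bsub>D\<^esub> m = d"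
proof -
  interpret D: comm_group D using D by (simp add: injective_group_def)
  have f: "(\<lambda>z. m * z) \<in> mon integer_group integer_group"
    using m by (auto simp: mon_def hom_def inj_on_def algebra_simps)
  have h: "(\<lambda>z::int. d [^]\<^bsub>D\<^esub> z) \<in> hom integer_group D"
    using d by (auto simp: hom_def D.int_pow_mult)
  obtain k where k: "k \<in> hom integer_group D" "\<And>z. k (m * z) = d [^]\<^bsub>D\<^esub> z"
    using D f h abelian_integer_group unfolding injective_group_def
    by (metis UNIV_I carrier_integer_group)
  have gh: "group_hom integer_group D k"
    using k(1) by (simp add: group_hom_def group_hom_axioms_def)
  have "k (1 [^]\<^bsub>integer_group\<^esub> m) = k 1 [^]\<^bsub>D\<^esub> m"
    using group_hom.hom_int_pow[OF gh, of 1 m] by simp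
  moreover have "1 [^]\<^bsub>integer_group\<^esub> m = m"
    using m by (metis mult.right_neutral group_nat_pow_integer_group int_pow_int pos_int_cases)
  ultimately have "k 1 [^]\<^bsub>D\<^esub> m = d"
    using k(2)[of 1] d by simp
  moreover have "k 1 \<in> carrier D" using k(1) by (auto simp: hom_def)
  ultimately show ?thesis by blast
qed

theorem injective_group_extend:
  fixes D :: "('d, 'm) monoid_scheme" and A :: "('s, 'p) monoid_scheme"
    and B :: "('t, 'q) monoid_scheme"
  assumes D: "injective_group D" and A: "comm_group A" and B: "comm_group B"
    and f: "f \<in> mon A B" and h: "h \<in> hom A D"
  shows "\<exists>k \<in> hom B D. \<forall>a \<in> carrier A. k (f a) = h a"
proof -
  interpret A: comm_group A by (fact A)
  interpret B: comm_group B by (fact B)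
  interpret D: comm_group D using D by (simp add: injective_group_def)
  have fhom: "f \<in> hom A B" and finj: "inj_on f (carrier A)" using f by (auto simp: mon_def)
  interpret F: group_hom A B f using fhom by unfold_locales
  interpret H: group_hom A D h using h by unfold_locales
  define ok where "ok R \<longleftrightarrow> R \<subseteq> carrier B \<times> carrier D \<and> (\<forall>a\<in>carrier A. (f a, h a) \<in> R) \<and>
      (\<forall>x y u v. (x, u) \<in> R \<longrightarrow> (y, v) \<in> R \<longrightarrow> (x \<otimes>\<^bsub>B\<^esub> y, u \<otimes>\<^bsub>D\<^esub> v) \<in> R) \<and>
      (\<forall>x u. (x, u) \<in> R \<longrightarrow> (inv\<^bsub>B\<^esub> x, inv\<^bsub>D\<^esub> u) \<in> R) \<and>
      (\<forall>u. (\<one>\<^bsub>B\<^esub>, u) \<in> R \<longrightarrow> u = \<one>\<^bsub>D\<^esub>)" for R :: "('t \<times> 'd) set"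
  define R0 where "R0 = (\<lambda>a. (f a, h a)) ` carrier A"
  have ok0: "ok R0"
    unfolding ok_def
  proof (intro conjI allI impI)
    show "(x \<otimes>\<^bsub>B\<^esub> y, u \<otimes>\<^bsub>D\<^esub> v) \<in> R0" if "(x, u) \<in> R0" "(y, v) \<in> R0" for x y u v
      using that unfolding R0_def
      by (auto simp flip: F.hom_mult H.hom_mult)
    show "(inv\<^bsub>B\<^esub> x, inv\<^bsub>D\<^esub> u) \<in> R0" if "(x, u) \<in> R0" for x u
      using that unfolding R0_def by (auto simp flip: F.hom_inv H.hom_inv)
    show "u = \<one>\<^bsub>D\<^esub>" if u: "(\<one>\<^bsub>B\<^esub>, u) \<in> R0" for u
    proof -
      obtain a where a: "a \<in> carrier A" "f a = \<one>\<^bsub>B\<^esub>" "u = h a" using u by (auto simp: R0_def)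
      then have "a = \<one>\<^bsub>A\<^esub>" using finj F.hom_one by (metis A.one_closed inj_onD)
      then show ?thesis using a by simp
    qed
  qed (auto simp: R0_def)
  have "\<exists>M\<in>Collect ok. \<forall>R\<in>Collect ok. M \<subseteq> R \<longrightarrow> R = M"
  proof (rule subset_Zorn_nonempty)
    show "Collect ok \<noteq> {}" using ok0 by auto
    fix \<C> assume ne: "\<C> \<noteq> {}" and ch: "subset.chain (Collect ok) \<C>"
    have okC: "ok R" if "R \<in> \<C>" for R using ch that by (auto simp: subset_chain_def)
    have two: "\<exists>R\<in>\<C>. p \<in> R \<and> q \<in> R" if pq: "p \<in> \<Union>\<C>" "q \<in> \<Union>\<C>" for p q
    proof -
      obtain R S where RS: "R \<in> \<C>" "S \<in> \<C>" "p \<in> R" "q \<in> S" using pq by blast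
      then have "R \<subseteq> S \<or> S \<subseteq> R" using ch unfolding subset_chain_def by blast
      then show ?thesis using RS by blast
    qed
    have "ok (\<Union>\<C>)"
      unfolding ok_def
    proof (intro conjI allI impI)
      show "\<Union>\<C> \<subseteq> carrier B \<times> carrier D" using okC unfolding ok_def by blast
      show "\<forall>a\<in>carrier A. (f a, h a) \<in> \<Union>\<C>" using ne okC unfolding ok_def by blast
      show "(x \<otimes>\<^bsub>B\<^esub> y, u \<otimes>\<^bsub>D\<^esub> v) \<in> \<Union>\<C>" if xy: "(x, u) \<in> \<Union>\<C>" "(y, v) \<in> \<Union>\<C>" for x y u v
      proof -
        obtain R where "R \<in> \<C>" "(x, u) \<in> R" "(y, v) \<in> R" using two[OF xy] by blast
        then show ?thesis using okC[of R] unfolding ok_def by blast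
      qed
      show "(inv\<^bsub>B\<^esub> x, inv\<^bsub>D\<^esub> u) \<in> \<Union>\<C>" if "(x, u) \<in> \<Union>\<C>" for x u
        using that okC unfolding ok_def by blast
      show "u = \<one>\<^bsub>D\<^esub>" if "(\<one>\<^bsub>B\<^esub>, u) \<in> \<Union>\<C>" for u
        using that okC unfolding ok_def by blast
    qed
    then show "\<Union>\<C> \<in> Collect ok" by simp
  qed
  then obtain M where okM: "ok M" and Mmax: "\<And>R. ok R \<Longrightarrow> M \<subseteq> R \<Longrightarrow> R = M" by auto
  have Mc: "\<And>x u. (x, u) \<in> M \<Longrightarrow> x \<in> carrier B \<and> u \<in> carrier D"
    and Mf: "\<And>a. a \<in> carrier A \<Longrightarrow> (f a, h a) \<in> M"
    and Mm: "\<And>x y u v. (x, u) \<in> M \<Longrightarrow> (y, v) \<in> M \<Longrightarrow> (x \<otimes>\<^bsub>B\<^esub> y, u \<otimes>\<^bsub>D\<^esub> v) \<in> M"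
    and Mi: "\<And>x u. (x, u) \<in> M \<Longrightarrow> (inv\<^bsub>B\<^esub> x, inv\<^bsub>D\<^esub> u) \<in> M"
    and M1: "\<And>u. (\<one>\<^bsub>B\<^esub>, u) \<in> M \<Longrightarrow> u = \<one>\<^bsub>D\<^esub>"
    using okM unfolding ok_def by blast+
  have Mone: "(\<one>\<^bsub>B\<^esub>, \<one>\<^bsub>D\<^esub>) \<in> M" using Mf[OF A.one_closed] by simp
  have Mn: "(x [^]\<^bsub>B\<^esub> n, u [^]\<^bsub>D\<^esub> n) \<in> M" if "(x, u) \<in> M" for x u and n :: nat
    by (induction n) (use Mone Mm that in auto)
  have Mp: "(x [^]\<^bsub>B\<^esub> n, u [^]\<^bsub>D\<^esub> n) \<in> M" if "(x, u) \<in> M" for x u and n :: int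
  proof (cases n rule: int_cases2)
    case (nonneg k)
    then show ?thesis using Mn[OF that, of k] by (simp add: int_pow_int)
  next
    case (nonpos k)
    have "x \<in> carrier B" "u \<in> carrier D" using Mc[OF that] by auto
    then show ?thesis using Mi[OF Mn[OF that, of k]] nonpos
      by (simp add: B.int_pow_neg D.int_pow_neg int_pow_int)
  qed
  have single: "u = v" if "(x, u) \<in> M" "(x, v) \<in> M" for x u v
  proof -
    have "(x \<otimes>\<^bsub>B\<^esub> inv\<^bsub>B\<^esub> x, u \<otimes>\<^bsub>D\<^esub> inv\<^bsub>D\<^esub> v) \<in> M" using Mm Mi that by blast
    then have "u \<otimes>\<^bsub>D\<^esub> inv\<^bsub>D\<^esub> v = \<one>\<^bsub>D\<^esub>" using M1 Mc[OF that(1)] by simp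
    then show ?thesis using Mc that by (metis D.inv_equality D.inv_inv D.inv_closed)
  qed
  have total: "\<exists>u. (x, u) \<in> M" if x: "x \<in> carrier B" for x
  proof -
    define T where "T = {n::nat. 0 < n \<and> (\<exists>u. (x [^]\<^bsub>B\<^esub> int n, u) \<in> M)}"
    have "\<exists>y\<in>carrier D. \<forall>n u. (x [^]\<^bsub>B\<^esub> (n::int), u) \<in> M \<longrightarrow> u = y [^]\<^bsub>D\<^esub> n"
    proof (cases "T = {}")
      case True
      have "n = 0" if n: "(x [^]\<^bsub>B\<^esub> (n::int), u) \<in> M" for n u
      proof (rule ccontr)
        assume "n \<noteq> 0"
        have "(x [^]\<^bsub>B\<^esub> (- n), inv\<^bsub>D\<^esub> u) \<in> M" using Mi[OF n] x by (simp add: B.int_pow_neg)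
        with n have "\<exists>u. (x [^]\<^bsub>B\<^esub> int (nat \<bar>n\<bar>), u) \<in> M" by (cases "n \<ge> 0") auto
        then have "nat \<bar>n\<bar> \<in> T" using \<open>n \<noteq> 0\<close> by (auto simp: T_def)
        then show False using True by auto
      qed
      then have "u = \<one>\<^bsub>D\<^esub> [^]\<^bsub>D\<^esub> n" if n: "(x [^]\<^bsub>B\<^esub> (n::int), u) \<in> M" for n u
        using n M1 by fastforce
      then show ?thesis by blast
    next
      case False
      define m where "m = (LEAST n. n \<in> T)"
      have mT: "m \<in> T" using False unfolding m_def by (metis LeastI_ex ex_in_conv)
      have mle: "m \<le> n" if "n \<in> T" for n using that unfolding m_def by (rule Least_le)
      obtain d where d: "(x [^]\<^bsub>B\<^esub> int m, d) \<in> M" and m0: "0 < m" using mT by (auto simp: T_def)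
      obtain y where y: "y \<in> carrier D" "y [^]\<^bsub>D\<^esub> int m = d"
        using injective_group_divisible[OF D, of d "int m"] Mc[OF d] m0 by auto
      have "u = y [^]\<^bsub>D\<^esub> n" if n: "(x [^]\<^bsub>B\<^esub> (n::int), u) \<in> M" for n u
      proof -
        define q r where "q = n div int m" and "r = n mod int m"
        have nq: "n = int m * q + r" and r: "0 \<le> r" "r < int m"
          using m0 by (auto simp: q_def r_def)
        have e: "(x [^]\<^bsub>B\<^esub> (int m * q), y [^]\<^bsub>D\<^esub> (int m * q)) \<in> M"
          using Mp[OF d, of q] x y(1) by (simp add: B.int_pow_pow D.int_pow_pow flip: y(2))
        have "(x [^]\<^bsub>B\<^esub> n \<otimes>\<^bsub>B\<^esub> inv\<^bsub>B\<^esub> (x [^]\<^bsub>B\<^esub> (int m * q)), u \<otimes>\<^bsub>D\<^esub> inv\<^bsub>D\<^esub> (y [^]\<^bsub>D\<^esub> (int m * q))) \<in> M"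
          using Mm[OF n Mi[OF e]] .
        moreover have "x [^]\<^bsub>B\<^esub> n \<otimes>\<^bsub>B\<^esub> inv\<^bsub>B\<^esub> (x [^]\<^bsub>B\<^esub> (int m * q)) = x [^]\<^bsub>B\<^esub> r"
          using B.int_pow_diff[OF x, of n "int m * q"] nq by simp
        ultimately have "r = 0" using mle[of "nat r"] r by (force simp: T_def)
        then show ?thesis using single n e nq by simp
      qed
      then show ?thesis using y by blast
    qed
    then obtain y where y: "y \<in> carrier D"
      and ext: "\<And>n u. (x [^]\<^bsub>B\<^esub> (n::int), u) \<in> M \<Longrightarrow> u = y [^]\<^bsub>D\<^esub> n" by blast
    define R where "R = {(s \<otimes>\<^bsub>B\<^esub> x [^]\<^bsub>B\<^esub> n, t \<otimes>\<^bsub>D\<^esub> y [^]\<^bsub>D\<^esub> n) | s t (n::int). (s, t) \<in> M}"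
    have RI: "(s \<otimes>\<^bsub>B\<^esub> x [^]\<^bsub>B\<^esub> n, t \<otimes>\<^bsub>D\<^esub> y [^]\<^bsub>D\<^esub> n) \<in> R" if "(s, t) \<in> M" for s t and n :: int
      using that unfolding R_def by blast
    have MR: "M \<subseteq> R"
    proof clarify
      fix s t assume st: "(s, t) \<in> M"
      show "(s, t) \<in> R" using RI[OF st, of 0] Mc[OF st] by simp
    qed
    have "ok R"
      unfolding ok_def
    proof (intro conjI allI impI)
      show "R \<subseteq> carrier B \<times> carrier D" using Mc x y by (auto simp: R_def)
      show "\<forall>a\<in>carrier A. (f a, h a) \<in> R" using Mf MR by blast
      show "(p \<otimes>\<^bsub>B\<^esub> q, u \<otimes>\<^bsub>D\<^esub> v) \<in> R" if pu: "(p, u) \<in> R" "(q, v) \<in> R" for p q u v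
      proof -
        obtain s t n s' t' n' where st: "(s, t) \<in> M" "(s', t') \<in> M"
          and eq: "p = s \<otimes>\<^bsub>B\<^esub> x [^]\<^bsub>B\<^esub> (n::int)" "u = t \<otimes>\<^bsub>D\<^esub> y [^]\<^bsub>D\<^esub> n"
            "q = s' \<otimes>\<^bsub>B\<^esub> x [^]\<^bsub>B\<^esub> (n'::int)" "v = t' \<otimes>\<^bsub>D\<^esub> y [^]\<^bsub>D\<^esub> n'"
          using pu unfolding R_def by blast
        have "p \<otimes>\<^bsub>B\<^esub> q = (s \<otimes>\<^bsub>B\<^esub> s') \<otimes>\<^bsub>B\<^esub> x [^]\<^bsub>B\<^esub> (n + n')"
          using Mc[OF st(1)] Mc[OF st(2)] x by (simp add: eq B.int_pow_mult B.m_ac)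
        moreover have "u \<otimes>\<^bsub>D\<^esub> v = (t \<otimes>\<^bsub>D\<^esub> t') \<otimes>\<^bsub>D\<^esub> y [^]\<^bsub>D\<^esub> (n + n')"
          using Mc[OF st(1)] Mc[OF st(2)] y by (simp add: eq D.int_pow_mult D.m_ac)
        ultimately show ?thesis using RI[OF Mm[OF st], of "n + n'"] by simp
      qed
      show "(inv\<^bsub>B\<^esub> p, inv\<^bsub>D\<^esub> u) \<in> R" if pu: "(p, u) \<in> R" for p u
      proof -
        obtain s t n where st: "(s, t) \<in> M"
          and eq: "p = s \<otimes>\<^bsub>B\<^esub> x [^]\<^bsub>B\<^esub> (n::int)" "u = t \<otimes>\<^bsub>D\<^esub> y [^]\<^bsub>D\<^esub> n"
          using pu unfolding R_def by blast
        have "inv\<^bsub>B\<^esub> p = inv\<^bsub>B\<^esub> s \<otimes>\<^bsub>B\<^esub> x [^]\<^bsub>B\<^esub> (- n)"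
          using Mc[OF st] x by (simp add: eq B.int_pow_neg B.inv_mult)
        moreover have "inv\<^bsub>D\<^esub> u = inv\<^bsub>D\<^esub> t \<otimes>\<^bsub>D\<^esub> y [^]\<^bsub>D\<^esub> (- n)"
          using Mc[OF st] y by (simp add: eq D.int_pow_neg D.inv_mult)
        ultimately show ?thesis using RI[OF Mi[OF st], of "- n"] by simp
      qed
      show "u = \<one>\<^bsub>D\<^esub>" if pu: "(\<one>\<^bsub>B\<^esub>, u) \<in> R" for u
      proof -
        obtain s t n where st: "(s, t) \<in> M"
          and eq: "\<one>\<^bsub>B\<^esub> = s \<otimes>\<^bsub>B\<^esub> x [^]\<^bsub>B\<^esub> (n::int)" "u = t \<otimes>\<^bsub>D\<^esub> y [^]\<^bsub>D\<^esub> n"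
          using pu unfolding R_def by blast
        have "inv\<^bsub>B\<^esub> s = x [^]\<^bsub>B\<^esub> n"
          using Mc[OF st] x eq(1) by (metis B.inv_equality B.int_pow_closed B.m_comm)
        then have "inv\<^bsub>D\<^esub> t = y [^]\<^bsub>D\<^esub> n" using ext Mi[OF st] by simp
        then show ?thesis using eq(2) Mc[OF st] by (metis D.r_inv)
      qed
    qed
    then have "R = M" using Mmax MR by blast
    moreover have "(x, y) \<in> R" using RI[OF Mone, of 1] x y by simp
    ultimately show ?thesis by blast
  qed
  define k where "k x = (THE u. (x, u) \<in> M)" for x
  have kM: "k x = u" if "(x, u) \<in> M" for x u
    unfolding k_def using that single by blast
  have kin: "(x, k x) \<in> M" if "x \<in> carrier B" for x
    using total[OF that] kM by blast
  have "k \<in> hom B D"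
    using kin Mc kM Mm by (auto simp: hom_def)
  moreover have "k (f a) = h a" if "a \<in> carrier A" for a using kM Mf that by blast
  ultimately show ?thesis by blast
qed

text \<open>A resolution \<open>0 \<rightarrow> G \<rightarrow> G' \<rightarrow> G'' \<rightarrow> 0\<close> with maps \<open>\<iota>\<close> and \<open>\<beta>\<close>.\<close>

definition injective_resolution ::
  "'g monoid \<Rightarrow> ('g \<Rightarrow> 'd) \<Rightarrow> 'd monoid \<Rightarrow> ('d \<Rightarrow> 'e) \<Rightarrow> 'e monoid \<Rightarrow> bool" where
  "injective_resolution G \<iota> G' \<beta> G'' \<longleftrightarrow>
     comm_group G \<and> injective_group G' \<and> injective_group G'' \<and>
     \<iota> \<in> mon G G' \<and> kernel G' G'' \<beta> = \<iota> ` carrier G \<and> \<beta> \<in> epi G' G''"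


section \<open>Alexander-Spanier normal cochains\<close>

text \<open>All complexes are indexed by integers, the cochain groups being trivial in negative degrees.
  This matters in degree \<open>-1\<close>, where the chain cone still has the summand \<open>Hom(C\<^sup>0; G'')\<close>.
  A point of \<open>S\<^sup>n\<^sup>+\<^sup>1\<close> is a list of length \<open>n + 1\<close>; the empty list is excluded, so there are no
  tuples for \<open>n < 0\<close>.\<close>

definition tuples :: "int \<Rightarrow> 'a set \<Rightarrow> 'a list set" where
  "tuples n S = {xs. set xs \<subseteq> S \<and> xs \<noteq> [] \<and> int (length xs) = n + 1}"

definition cochain_group :: "int \<Rightarrow> 'a topology \<Rightarrow> ('a list \<Rightarrow> int) monoid" where
  "cochain_group n X = product_group (tuples n (topspace X)) (\<lambda>_. integer_group)"

definition coboundary :: "int \<Rightarrow> 'a topology \<Rightarrow> ('a list \<Rightarrow> int) \<Rightarrow> 'a list \<Rightarrow> int" where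
  "coboundary n X \<phi> =
     (\<lambda>xs \<in> tuples (n + 1) (topspace X).
        if n < 0 then 0 else \<Sum>i<length xs. (-1) ^ i * \<phi> (take i xs @ drop (Suc i) xs))"

definition locally_zero :: "int \<Rightarrow> 'a topology \<Rightarrow> ('a list \<Rightarrow> int) set" where
  "locally_zero n X = {\<phi> \<in> carrier (cochain_group n X).
     \<exists>\<U>. normal_covering X \<U> \<and> (\<forall>xs \<in> (\<Union>U\<in>\<U>. tuples n U). \<phi> xs = 0)}"

definition normal_cochain_group :: "int \<Rightarrow> 'a topology \<Rightarrow> ('a list \<Rightarrow> int) set monoid" where
  "normal_cochain_group n X = cochain_group n X Mod locally_zero n X"

text \<open>The map between quotients, with values in cosets of \<open>N\<close> in \<open>H\<close>, induced by a homomorphism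
  \<open>h\<close> into \<open>H\<close>; the image below is a singleton when \<open>h\<close> respects the subgroups.\<close>

definition coset_map :: "('b, 'm) monoid_scheme \<Rightarrow> 'b set \<Rightarrow> ('a \<Rightarrow> 'b) \<Rightarrow> 'a set \<Rightarrow> 'b set" where
  "coset_map H N h c = the_elem ((\<lambda>x. N #>\<^bsub>H\<^esub> h x) ` c)"

definition normal_coboundary ::
  "int \<Rightarrow> 'a topology \<Rightarrow> ('a list \<Rightarrow> int) set \<Rightarrow> ('a list \<Rightarrow> int) set" where
  "normal_coboundary n X =
     coset_map (cochain_group (n + 1) X) (locally_zero (n + 1) X) (coboundary n X)"

text \<open>The cochain map induced by \<open>f : X \<rightarrow> Y\<close>. For a subspace \<open>A\<close> of \<open>Y\<close>, the restriction to \<open>A\<close> is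
  the case \<open>X = subtopology Y A\<close>, \<open>f = id\<close>.\<close>

definition normal_cochain_map ::
  "int \<Rightarrow> 'a topology \<Rightarrow> ('a \<Rightarrow> 'b) \<Rightarrow> ('b list \<Rightarrow> int) set \<Rightarrow> ('a list \<Rightarrow> int) set" where
  "normal_cochain_map n X f =
     coset_map (cochain_group n X) (locally_zero n X)
       (\<lambda>\<phi>. \<lambda>xs \<in> tuples n (topspace X). \<phi> (map f xs))"

definition rel_normal_cochain_group ::
  "'a topology \<Rightarrow> 'a set \<Rightarrow> int \<Rightarrow> ('a list \<Rightarrow> int) set monoid" where
  "rel_normal_cochain_group X A n =
     (normal_cochain_group n X)
       \<lparr>carrier := kernel (normal_cochain_group n X) (normal_cochain_group n (subtopology X A))
                    (normal_cochain_map n (subtopology X A) id)\<rparr>"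


section \<open>Chain cones and homology\<close>

definition hom_group :: "('a, 'm) monoid_scheme \<Rightarrow> ('b, 'k) monoid_scheme \<Rightarrow> ('a \<Rightarrow> 'b) monoid" where
  "hom_group C D =
     \<lparr>carrier = hom C D \<inter> extensional (carrier C),
      monoid.mult = (\<lambda>f g. \<lambda>c \<in> carrier C. f c \<otimes>\<^bsub>D\<^esub> g c),
      one = (\<lambda>c \<in> carrier C. \<one>\<^bsub>D\<^esub>)\<rparr>"

text \<open>\<open>C\<close> is a cochain complex with differentials \<open>\<delta> n\<close> from \<open>C n\<close> to \<open>C (n + 1)\<close>.\<close>

definition cone_group ::
  "(int \<Rightarrow> 'c monoid) \<Rightarrow> 'd monoid \<Rightarrow> 'e monoid \<Rightarrow> int \<Rightarrow> (('c \<Rightarrow> 'd) \<times> ('c \<Rightarrow> 'e)) monoid" where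
  "cone_group C G' G'' n = hom_group (C n) G' \<times>\<times> hom_group (C (n + 1)) G''"

definition cone_boundary ::
  "(int \<Rightarrow> 'c monoid) \<Rightarrow> (int \<Rightarrow> 'c \<Rightarrow> 'c) \<Rightarrow> ('d \<Rightarrow> 'e) \<Rightarrow> 'e monoid \<Rightarrow> int \<Rightarrow>
   ('c \<Rightarrow> 'd) \<times> ('c \<Rightarrow> 'e) \<Rightarrow> ('c \<Rightarrow> 'd) \<times> ('c \<Rightarrow> 'e)" where
  "cone_boundary C \<delta> \<beta> G'' n = (\<lambda>(\<phi>', \<phi>'').
     (\<lambda>c \<in> carrier (C (n - 1)). \<phi>' (\<delta> (n - 1) c),
      \<lambda>c \<in> carrier (C n). \<beta> (\<phi>' c) \<otimes>\<^bsub>G''\<^esub> inv\<^bsub>G''\<^esub> \<phi>'' (\<delta> n c)))"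

definition chain_homology ::
  "(int \<Rightarrow> 'k monoid) \<Rightarrow> (int \<Rightarrow> 'k \<Rightarrow> 'k) \<Rightarrow> int \<Rightarrow> 'k set monoid" where
  "chain_homology K d n =
     (K n)\<lparr>carrier := kernel (K n) (K (n - 1)) (d n)\<rparr> Mod (d (n + 1) ` carrier (K (n + 1)))"


section \<open>Alexander-Spanier normal homology\<close>

type_synonym ('a, 'd, 'e) normal_chain =
  "(('a list \<Rightarrow> int) set \<Rightarrow> 'd) \<times> (('a list \<Rightarrow> int) set \<Rightarrow> 'e)"

definition normal_chain_group ::
  "'d monoid \<Rightarrow> 'e monoid \<Rightarrow> 'a topology \<Rightarrow> 'a set \<Rightarrow> int \<Rightarrow> ('a, 'd, 'e) normal_chain monoid" where
  "normal_chain_group G' G'' X A = cone_group (rel_normal_cochain_group X A) G' G''"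

definition normal_boundary ::
  "('d \<Rightarrow> 'e) \<Rightarrow> 'e monoid \<Rightarrow> 'a topology \<Rightarrow> 'a set \<Rightarrow> int \<Rightarrow>
   ('a, 'd, 'e) normal_chain \<Rightarrow> ('a, 'd, 'e) normal_chain" where
  "normal_boundary \<beta> G'' X A =
     cone_boundary (rel_normal_cochain_group X A) (\<lambda>n. normal_coboundary n X) \<beta> G''"

definition rel_normal_homology ::
  "'d monoid \<Rightarrow> ('d \<Rightarrow> 'e) \<Rightarrow> 'e monoid \<Rightarrow> int \<Rightarrow> 'a topology \<Rightarrow> 'a set \<Rightarrow>
   ('a, 'd, 'e) normal_chain set monoid" where
  "rel_normal_homology G' \<beta> G'' n X A =
     chain_homology (normal_chain_group G' G'' X A) (normal_boundary \<beta> G'' X A) n"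

abbreviation normal_homology ::
  "'d monoid \<Rightarrow> ('d \<Rightarrow> 'e) \<Rightarrow> 'e monoid \<Rightarrow> int \<Rightarrow> 'a topology \<Rightarrow>
   ('a, 'd, 'e) normal_chain set monoid" where
  "normal_homology G' \<beta> G'' n X \<equiv> rel_normal_homology G' \<beta> G'' n X {}"

text \<open>The maps induced by a map of pairs \<open>f : (X, A) \<rightarrow> (Y, B)\<close>.\<close>

definition normal_chain_map ::
  "int \<Rightarrow> 'a topology \<Rightarrow> 'b topology \<Rightarrow> 'b set \<Rightarrow> ('a \<Rightarrow> 'b) \<Rightarrow>
   ('a, 'd, 'e) normal_chain \<Rightarrow> ('b, 'd, 'e) normal_chain" where
  "normal_chain_map n X Y B f = (\<lambda>(\<phi>', \<phi>'').
     (\<lambda>c \<in> carrier (rel_normal_cochain_group Y B n). \<phi>' (normal_cochain_map n X f c),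
      \<lambda>c \<in> carrier (rel_normal_cochain_group Y B (n + 1)). \<phi>'' (normal_cochain_map (n + 1) X f c)))"

definition normal_hom_induced ::
  "'d monoid \<Rightarrow> ('d \<Rightarrow> 'e) \<Rightarrow> 'e monoid \<Rightarrow> int \<Rightarrow> 'a topology \<Rightarrow> 'b topology \<Rightarrow> 'b set \<Rightarrow>
   ('a \<Rightarrow> 'b) \<Rightarrow> ('a, 'd, 'e) normal_chain set \<Rightarrow> ('b, 'd, 'e) normal_chain set" where
  "normal_hom_induced G' \<beta> G'' n X Y B f =
     coset_map (normal_chain_group G' G'' Y B n)
       (normal_boundary \<beta> G'' Y B (n + 1) ` carrier (normal_chain_group G' G'' Y B (n + 1)))
       (normal_chain_map n X Y B f)"

end

theory Submission
  imports Defs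
begin

text \<open>By definition of the relative groups, and because a cochain on \<open>A\<close> extends to \<open>X\<close>,
  \<open>0 \<rightarrow> C\<^sup>*(X,A) \<rightarrow> C\<^sup>*(X) \<rightarrow> C\<^sup>*(A) \<rightarrow> 0\<close> is a short exact sequence of normal cochain complexes.
  Since \<open>G'\<close> and \<open>G''\<close> are injective, \<open>Hom(-, G')\<close> and \<open>Hom(-, G'')\<close> turn it into short exact
  sequences, and so the chain cones form a short exact sequence in the reverse order. The claim is
  its long exact homology sequence. The topological input is that the locally zero cochains form
  subgroups compatible with restriction, i.e. that normal coverings have normal common refinements
  and restrict to subspaces.\<close>

text \<open>The group underlying a cone is a product of two Hom groups; the coefficient map
  \<open>\<beta>\<close> and the coboundary enter only the boundary map. Exactness of the cones is
  therefore checked one Hom factor at a time, and only compatibility with the boundaries concerns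
  the cone as a whole. The map j is the identity on points, so on cochains it is an inclusion.
  Absolute groups are formally groups relative to the empty subspace; they agree with the plain
  normal cochain groups because every cochain of the empty space is locally zero. Injectivity is
  tested on groups over \<open>int\<close>, whereas the cochain groups consist of cosets of
  functions on lists; Baer's criterion bridges the two. Grading by all integers leaves no end of the
  sequence to be treated separately.\<close>

section \<open>Normal coverings\<close>

text \<open>No local finiteness is available. Instead, a partial sum over \<open>J\<close> is lower semicontinuous as
  a supremum of finite sums, and upper semicontinuous because the complementary sum is lower
  semicontinuous.\<close>

lemma continuous_map_infsum_subset:
  fixes f :: "'i \<Rightarrow> 'a \<Rightarrow> real"
  assumes f: "\<And>i. i \<in> I \<Longrightarrow> continuous_map X euclideanreal (f i)"
    and f0: "\<And>i x. i \<in> I \<Longrightarrow> x \<in> topspace X \<Longrightarrow> 0 \<le> f i x"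
    and s: "continuous_map X euclideanreal s"
    and fs: "\<And>x. x \<in> topspace X \<Longrightarrow> ((\<lambda>i. f i x) has_sum s x) I"
    and J: "J \<subseteq> I"
  shows "continuous_map X euclideanreal (\<lambda>x. infsum (\<lambda>i. f i x) J)"
proof -
  have smb: "(\<lambda>i. f i x) summable_on K" if "x \<in> topspace X" "K \<subseteq> I" for x K
    using fs[OF that(1)] that(2) summable_on_subset_banach has_sum_imp_summable by blast
  have less_iff: "a < infsum (\<lambda>i. f i x) K \<longleftrightarrow> (\<exists>F. finite F \<and> F \<subseteq> K \<and> a < (\<Sum>i\<in>F. f i x))"
    if x: "x \<in> topspace X" and K: "K \<subseteq> I" for x a K
  proof
    assume a: "a < infsum (\<lambda>i. f i x) K"
    have "sum (\<lambda>i. f i x) F \<le> a" if "\<not> (\<exists>F. finite F \<and> F \<subseteq> K \<and> a < (\<Sum>i\<in>F. f i x))"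
      "finite F" "F \<subseteq> K" for F
      using that by (meson not_le)
    then show "\<exists>F. finite F \<and> F \<subseteq> K \<and> a < (\<Sum>i\<in>F. f i x)"
      using infsum_le_finite_sums[OF smb[OF x K], of a] a by fastforce
  next
    assume "\<exists>F. finite F \<and> F \<subseteq> K \<and> a < (\<Sum>i\<in>F. f i x)"
    then obtain F where F: "finite F" "F \<subseteq> K" "a < (\<Sum>i\<in>F. f i x)" by blast
    have "(\<Sum>i\<in>F. f i x) \<le> infsum (\<lambda>i. f i x) K"
      using F K f0 x by (intro finite_sum_le_infsum smb) auto
    then show "a < infsum (\<lambda>i. f i x) K" using F by simp
  qed
  have split: "infsum (\<lambda>i. f i x) J = s x - infsum (\<lambda>i. f i x) (I - J)"
    if x: "x \<in> topspace X" for x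
    using infsum_Diff[OF smb[OF x order_refl] smb[OF x J] J] infsumI[OF fs[OF x]] by simp
  have contF: "continuous_map X euclideanreal (\<lambda>x. \<Sum>i\<in>F. f i x)" if "finite F" "F \<subseteq> I" for F
    using that by (intro continuous_map_sum f) auto
  have above: "openin X {x \<in> topspace X. infsum (\<lambda>i. f i x) J > a}" for a
  proof -
    have "{x \<in> topspace X. infsum (\<lambda>i. f i x) J > a} =
        (\<Union>F\<in>{F. finite F \<and> F \<subseteq> J}. {x \<in> topspace X. (\<Sum>i\<in>F. f i x) > a})"
      using less_iff[OF _ J] by auto
    moreover have "openin X {x \<in> topspace X. (\<Sum>i\<in>F. f i x) > a}" if "finite F" "F \<subseteq> J" for F
      using contF[OF that(1) subset_trans[OF that(2) J]]
      by (simp add: continuous_map_upper_lower_semicontinuous_lt)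
    ultimately show ?thesis by (auto intro!: openin_Union)
  qed
  have below: "openin X {x \<in> topspace X. infsum (\<lambda>i. f i x) J < a}" for a
  proof -
    have "infsum (\<lambda>i. f i x) J < a \<longleftrightarrow>
        (\<exists>F. finite F \<and> F \<subseteq> I - J \<and> s x - (\<Sum>i\<in>F. f i x) < a)" if x: "x \<in> topspace X" for x
    proof -
      have "infsum (\<lambda>i. f i x) J < a \<longleftrightarrow> s x - a < infsum (\<lambda>i. f i x) (I - J)"
        using split[OF x] by auto
      also have "\<dots> \<longleftrightarrow> (\<exists>F. finite F \<and> F \<subseteq> I - J \<and> s x - a < (\<Sum>i\<in>F. f i x))"
        by (rule less_iff[OF x]) auto
      finally show ?thesis by (simp add: algebra_simps)
    qed
    then have "{x \<in> topspace X. infsum (\<lambda>i. f i x) J < a} =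
        (\<Union>F\<in>{F. finite F \<and> F \<subseteq> I - J}. {x \<in> topspace X. s x - (\<Sum>i\<in>F. f i x) < a})"
      by auto
    moreover have "openin X {x \<in> topspace X. s x - (\<Sum>i\<in>F. f i x) < a}"
      if "finite F" "F \<subseteq> I - J" for F
    proof -
      have "continuous_map X euclideanreal (\<lambda>x. s x - (\<Sum>i\<in>F. f i x))"
        using that by (intro continuous_map_diff s contF) auto
      then show ?thesis by (simp add: continuous_map_upper_lower_semicontinuous_lt)
    qed
    ultimately show ?thesis by (auto intro!: openin_Union)
  qed
  show ?thesis
    using above below by (simp add: continuous_map_upper_lower_semicontinuous_lt)
qed

text \<open>Indices with the same \<open>W i\<close> are grouped together, since partitions of unity are indexed by
  the members of the covering.\<close>

lemma normal_covering_image: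
  fixes f :: "'i \<Rightarrow> 'a \<Rightarrow> real"
  assumes W: "\<And>i. i \<in> I \<Longrightarrow> openin X (W i)" "(\<Union>i\<in>I. W i) = topspace X"
    and f: "\<And>i. i \<in> I \<Longrightarrow> continuous_map X euclideanreal (f i)"
    and f0: "\<And>i x. i \<in> I \<Longrightarrow> x \<in> topspace X \<Longrightarrow> 0 \<le> f i x"
    and supp: "\<And>i x. i \<in> I \<Longrightarrow> x \<in> topspace X \<Longrightarrow> f i x > 0 \<Longrightarrow> x \<in> W i"
    and fs: "\<And>x. x \<in> topspace X \<Longrightarrow> ((\<lambda>i. f i x) has_sum 1) I"
  shows "normal_covering X (W ` I)"
proof -
  define \<phi> where "\<phi> U x = infsum (\<lambda>i. f i x) {i \<in> I. W i = U}" for U x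
  have "partition_of_unity X (W ` I) \<phi>"
    unfolding partition_of_unity_def
  proof (intro conjI ballI)
    fix U assume "U \<in> W ` I"
    show "continuous_map X euclideanreal (\<phi> U)"
      unfolding \<phi>_def by (rule continuous_map_infsum_subset[where I = I and s = "\<lambda>_. 1"])
        (use f f0 fs in auto)
    show "0 \<le> \<phi> U x" if "x \<in> topspace X" for x
      unfolding \<phi>_def using f0 that by (intro infsum_nonneg) auto
    show "{x \<in> topspace X. 0 < \<phi> U x} \<subseteq> U"
    proof clarify
      fix x assume x: "x \<in> topspace X" "0 < \<phi> U x"
      have "\<exists>i\<in>{i \<in> I. W i = U}. f i x > 0"
      proof (rule ccontr)
        assume "\<not> ?thesis"
        then have "f i x \<le> 0" if "i \<in> {i \<in> I. W i = U}" for i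
          using that not_less by blast
        moreover have "0 \<le> f i x" if "i \<in> {i \<in> I. W i = U}" for i
          using f0[of i x] x(1) that by simp
        ultimately have "f i x = 0" if "i \<in> {i \<in> I. W i = U}" for i
          using that by (intro antisym)
        then have "infsum (\<lambda>i. f i x) {i \<in> I. W i = U} = 0"
          by (rule infsum_0)
        then show False using x by (simp add: \<phi>_def)
      qed
      then show "x \<in> U" using supp x by auto
    qed
  next
    fix x assume x: "x \<in> topspace X"
    \<comment> \<open>\<open>I\<close> is the disjoint union of the fibres of \<open>W\<close>, so
      summing over each fibre first and over the members of the covering afterwards still gives
      1.\<close>
    have "bij_betw (\<lambda>i. (W i, i)) I (SIGMA U : W ` I. {i \<in> I. W i = U})"
      by (auto simp: bij_betw_def inj_on_def)
    from has_sum_reindex_bij_betw[OF this, of "\<lambda>(U, i). f i x"]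
    have "((\<lambda>(U, i). f i x) has_sum 1) (SIGMA U : W ` I. {i \<in> I. W i = U})"
      using fs[OF x] by simp
    then show "((\<lambda>U. \<phi> U x) has_sum 1) (W ` I)"
    proof (rule has_sum_SigmaD)
      fix U
      have "(\<lambda>i. f i x) summable_on {i \<in> I. W i = U}"
        by (rule summable_on_subset_banach[OF has_sum_imp_summable[OF fs[OF x]]]) auto
      then show "((\<lambda>i. case (U, i) of (U, i) \<Rightarrow> f i x) has_sum \<phi> U x) {i \<in> I. W i = U}"
        by (simp add: \<phi>_def)
    qed
  qed
  then show ?thesis using W unfolding normal_covering_def by auto
qed

text \<open>Products of the two partitions of unity are indexed by pairs. Distinct pairs can have
  the same intersection, so the partition for the refinement is obtained through
  \<open>normal_covering_image\<close>.\<close>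

lemma normal_covering_Int:
  assumes U: "normal_covering X \<U>" and V: "normal_covering X \<V>"
  shows "normal_covering X ((\<lambda>(U, V). U \<inter> V) ` (\<U> \<times> \<V>))"
proof -
  obtain \<phi> where \<phi>: "partition_of_unity X \<U> \<phi>" using U by (auto simp: normal_covering_def)
  obtain \<psi> where \<psi>: "partition_of_unity X \<V> \<psi>" using V by (auto simp: normal_covering_def)
  show ?thesis
  proof (rule normal_covering_image[where f = "\<lambda>(U, V) x. \<phi> U x * \<psi> V x"])
    show "openin X (case p of (U, V) \<Rightarrow> U \<inter> V)" if "p \<in> \<U> \<times> \<V>" for p
      using that U V by (auto simp: normal_covering_def)
    show "(\<Union>p\<in>\<U> \<times> \<V>. case p of (U, V) \<Rightarrow> U \<inter> V) = topspace X"
    proof -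
      have "(\<Union>p\<in>\<U> \<times> \<V>. case p of (U, V) \<Rightarrow> U \<inter> V) = \<Union>\<U> \<inter> \<Union>\<V>" by auto
      then show ?thesis using U V by (simp add: normal_covering_def)
    qed
    show "continuous_map X euclideanreal ((\<lambda>(U, V) x. \<phi> U x * \<psi> V x) p)" if "p \<in> \<U> \<times> \<V>" for p
      using that \<phi> \<psi> by (auto simp: partition_of_unity_def intro!: continuous_map_real_mult)
    show "0 \<le> (\<lambda>(U, V) x. \<phi> U x * \<psi> V x) p x" if "p \<in> \<U> \<times> \<V>" "x \<in> topspace X" for p x
      using that \<phi> \<psi> by (auto simp: partition_of_unity_def)
    show "x \<in> (case p of (U, V) \<Rightarrow> U \<inter> V)"
      if p: "p \<in> \<U> \<times> \<V>" and x: "x \<in> topspace X" and pos: "0 < (\<lambda>(U, V) x. \<phi> U x * \<psi> V x) p x" for p x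
    proof -
      obtain U V where UV: "p = (U, V)" "U \<in> \<U>" "V \<in> \<V>" using p by blast
      have "0 \<le> \<phi> U x" "0 \<le> \<psi> V x" using \<phi> \<psi> UV x by (auto simp: partition_of_unity_def)
      then have "0 < \<phi> U x" "0 < \<psi> V x" using pos UV by (auto simp: zero_less_mult_iff)
      then show ?thesis using \<phi> \<psi> UV x unfolding partition_of_unity_def by blast
    qed
    show "((\<lambda>p. (\<lambda>(U, V) x. \<phi> U x * \<psi> V x) p x) has_sum 1) (\<U> \<times> \<V>)" if x: "x \<in> topspace X" for x
    proof (rule has_sum_SigmaI)
      have hs: "((\<lambda>U. \<phi> U x) has_sum 1) \<U>" "((\<lambda>V. \<psi> V x) has_sum 1) \<V>"
        using \<phi> \<psi> x by (auto simp: partition_of_unity_def)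
      have inner: "((\<lambda>V. \<phi> U x * \<psi> V x) has_sum \<phi> U x) \<V>" for U
        using has_sum_cmult_right[OF hs(2), of "\<phi> U x"] by simp
      then show "((\<lambda>V. (\<lambda>(U, V) x. \<phi> U x * \<psi> V x) (U, V) x) has_sum \<phi> U x) \<V>" for U
        by simp
      show "((\<lambda>U. \<phi> U x) has_sum 1) \<U>" by (fact hs)
      \<comment> \<open>Nonnegativity of the products turns summability of the iterated sum into
        summability over all pairs.\<close>
      show "(\<lambda>p. (\<lambda>(U, V) x. \<phi> U x * \<psi> V x) p x) summable_on \<U> \<times> \<V>"
        by (rule summable_on_SigmaI[where g = "\<lambda>U. \<phi> U x"])
          (use inner hs has_sum_imp_summable[OF hs(1)] \<phi> \<psi> x in \<open>auto simp: partition_of_unity_def\<close>)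
    qed
  qed
qed

text \<open>Different members can have the same trace on \<open>A\<close>, so the restricted
  functions are again regrouped by \<open>normal_covering_image\<close>.\<close>

lemma normal_covering_subtopology:
  assumes U: "normal_covering X \<U>"
  shows "normal_covering (subtopology X A) ((\<lambda>U. U \<inter> A) ` \<U>)"
proof -
  obtain \<phi> where \<phi>: "partition_of_unity X \<U> \<phi>" using U by (auto simp: normal_covering_def)
  show ?thesis
    by (rule normal_covering_image[where f = \<phi>])
      (use U \<phi> in \<open>auto simp: normal_covering_def partition_of_unity_def openin_subtopology_Int
        intro: continuous_map_from_subtopology\<close>)
qed

section \<open>Maps between quotient groups\<close>

text \<open>Homology is a quotient of a group whose carrier is cut down to the cycles. Cosets see
  only the multiplication, so classes can be written in \<open>K n\<close> itself.\<close>

lemma r_coset_carrier_update: "N #>\<^bsub>G\<lparr>carrier := Z\<rparr>\<^esub> x = N #>\<^bsub>G\<^esub> x"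
  by (simp add: r_coset_def)

lemma comm_group_carrier_update:
  assumes "comm_group G" "subgroup Z G"
  shows "comm_group (G\<lparr>carrier := Z\<rparr>)"
proof -
  interpret comm_group G by fact
  show ?thesis
    by (rule group.group_comm_groupI[OF subgroup_imp_group[OF assms(2)]])
      (use m_comm subgroup.subset[OF assms(2)] in auto)
qed

lemma (in group) r_coset_eq_self_iff:
  assumes "subgroup N G" "x \<in> carrier G"
  shows "N #> x = N \<longleftrightarrow> x \<in> N"
  using assms by (metis coset_join2 rcos_self)

lemma coset_map_carrier_update: "coset_map (H\<lparr>carrier := Z\<rparr>) N h = coset_map H N h"
  by (simp add: coset_map_def r_coset_carrier_update fun_eq_iff)

text \<open>All elements of a coset have the same image coset, so the argument of
  \<open>the_elem\<close> is a singleton. This is the computation rule for induced maps between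
  quotients.\<close>

lemma coset_map_r_coset:
  assumes G: "group G" and H: "group H" and N: "subgroup N G" and M: "subgroup M H"
    and h: "h \<in> hom G H" and NM: "h ` N \<subseteq> M" and x: "x \<in> carrier G"
  shows "coset_map H M h (N #>\<^bsub>G\<^esub> x) = M #>\<^bsub>H\<^esub> h x"
proof -
  have "M #>\<^bsub>H\<^esub> h y = M #>\<^bsub>H\<^esub> h x" if "y \<in> N #>\<^bsub>G\<^esub> x" for y
  proof -
    obtain u where u: "u \<in> N" "y = u \<otimes>\<^bsub>G\<^esub> x" using \<open>y \<in> N #>\<^bsub>G\<^esub> x\<close> by (auto simp: r_coset_def)
    then have "h y = h u \<otimes>\<^bsub>H\<^esub> h x" using h x subgroup.mem_carrier[OF N] by (auto simp: hom_def)
    then have "h y \<in> M #>\<^bsub>H\<^esub> h x" using u NM by (auto simp: r_coset_def)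
    then show ?thesis
      using group.repr_independence[OF H _ _ M] h x by (metis hom_in_carrier)
  qed
  moreover have "x \<in> N #>\<^bsub>G\<^esub> x" by (rule group.rcos_self[OF G x N])
  ultimately have "(\<lambda>y. M #>\<^bsub>H\<^esub> h y) ` (N #>\<^bsub>G\<^esub> x) = {M #>\<^bsub>H\<^esub> h x}" by blast
  then show ?thesis by (simp add: coset_map_def)
qed

lemma coset_map_hom:
  assumes N: "N \<lhd> G" and M: "M \<lhd> H" and h: "h \<in> hom G H" and NM: "h ` N \<subseteq> M"
  shows "coset_map H M h \<in> hom (G Mod N) (H Mod M)"
proof -
  interpret N: normal N G by fact
  interpret M: normal M H by fact
  note eq = coset_map_r_coset[OF N.is_group M.is_group N.subgroup_axioms M.subgroup_axioms h NM]
  show ?thesis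
  proof (rule homI)
    fix c assume "c \<in> carrier (G Mod N)"
    then show "coset_map H M h c \<in> carrier (H Mod M)"
      using h by (auto simp: carrier_FactGroup eq hom_in_carrier)
  next
    fix c c' assume "c \<in> carrier (G Mod N)" "c' \<in> carrier (G Mod N)"
    then obtain x y where xy: "x \<in> carrier G" "y \<in> carrier G" "c = N #>\<^bsub>G\<^esub> x" "c' = N #>\<^bsub>G\<^esub> y"
      by (auto simp: carrier_FactGroup)
    then show "coset_map H M h (c \<otimes>\<^bsub>G Mod N\<^esub> c') = coset_map H M h c \<otimes>\<^bsub>H Mod M\<^esub> coset_map H M h c'"
      using h by (simp add: N.rcos_sum M.rcos_sum eq hom_in_carrier hom_mult)
  qed
qed

section \<open>The long exact homology sequence\<close>

locale chain_complex =
  fixes K :: "int \<Rightarrow> 'k monoid" and d :: "int \<Rightarrow> 'k \<Rightarrow> 'k"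
  assumes comm: "comm_group (K n)"
    and d_hom: "d n \<in> hom (K n) (K (n - 1))"
    and d_d: "x \<in> carrier (K (n + 1)) \<Longrightarrow> d n (d (n + 1) x) = \<one>\<^bsub>K (n - 1)\<^esub>"
begin

abbreviation cycles :: "int \<Rightarrow> 'k set" where
  "cycles n \<equiv> kernel (K n) (K (n - 1)) (d n)"

abbreviation boundaries :: "int \<Rightarrow> 'k set" where
  "boundaries n \<equiv> d (n + 1) ` carrier (K (n + 1))"

abbreviation homology_class :: "int \<Rightarrow> 'k \<Rightarrow> 'k set" where
  "homology_class n z \<equiv> boundaries n #>\<^bsub>K n\<^esub> z"

lemma grp [simp]: "group (K n)"
  using comm by (rule comm_group.axioms)

lemma d_group_hom: "group_hom (K n) (K (n - 1)) (d n)"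
  by (simp add: group_hom_def group_hom_axioms_def d_hom)

text \<open>The index \<open>n + 1 - 1\<close> is already simplified to \<open>n\<close>, so that
  facts about boundaries apply without rewriting.\<close>

lemma d_group_hom': "group_hom (K (n + 1)) (K n) (d (n + 1))"
  using d_group_hom[of "n + 1"] by simp

lemma d_closed: "x \<in> carrier (K n) \<Longrightarrow> d n x \<in> carrier (K (n - 1))"
  using d_hom by (rule hom_in_carrier)

lemma subgroup_cycles: "subgroup (cycles n) (K n)"
  by (rule group_hom.subgroup_kernel[OF d_group_hom])

lemma subgroup_boundaries: "subgroup (boundaries n) (K n)"
  by (rule group_hom.img_is_subgroup[OF d_group_hom'])

lemma boundaries_subset_cycles: "boundaries n \<subseteq> cycles n"
  using d_d d_closed[of _ "n + 1"] by (auto simp: kernel_def)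

lemma normal_boundaries: "boundaries n \<lhd> (K n)\<lparr>carrier := cycles n\<rparr>"
  using comm_group.subgroup_imp_normal[OF comm_group_carrier_update[OF comm subgroup_cycles]]
    group.subgroup_incl[OF grp subgroup_boundaries subgroup_cycles boundaries_subset_cycles]
  by blast

lemma group_homology [simp]: "group (chain_homology K d n)"
  unfolding chain_homology_def by (rule normal.factorgroup_is_group[OF normal_boundaries])

lemma carrier_homology: "carrier (chain_homology K d n) = homology_class n ` cycles n"
  by (simp add: chain_homology_def carrier_FactGroup r_coset_carrier_update)

lemma one_homology: "\<one>\<^bsub>chain_homology K d n\<^esub> = boundaries n"
  by (simp add: chain_homology_def)

lemma mult_homology:
  assumes "x \<in> cycles n" "y \<in> cycles n"
  shows "homology_class n x \<otimes>\<^bsub>chain_homology K d n\<^esub> homology_class n y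
    = homology_class n (x \<otimes>\<^bsub>K n\<^esub> y)"
  using normal.rcos_sum[OF normal_boundaries, of x n y] assms
  by (simp add: chain_homology_def r_coset_carrier_update)

lemma homology_class_eq_one_iff:
  assumes "x \<in> carrier (K n)"
  shows "homology_class n x = boundaries n \<longleftrightarrow> x \<in> boundaries n"
  by (rule group.r_coset_eq_self_iff[OF grp subgroup_boundaries assms])

end

section \<open>Maps induced by chain maps\<close>

locale chain_map = K: chain_complex K d + L: chain_complex L d'
  for K :: "int \<Rightarrow> 'k monoid" and d and L :: "int \<Rightarrow> 'l monoid" and d' +
  fixes f :: "int \<Rightarrow> 'k \<Rightarrow> 'l"
  assumes f_hom: "f n \<in> hom (K n) (L n)"
    and f_d: "x \<in> carrier (K n) \<Longrightarrow> f (n - 1) (d n x) = d' n (f n x)"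
begin

abbreviation induced :: "int \<Rightarrow> 'k set \<Rightarrow> 'l set" where
  "induced n \<equiv> coset_map (L n) (L.boundaries n) (f n)"

lemma f_group_hom: "group_hom (K n) (L n) (f n)"
  by (simp add: group_hom_def group_hom_axioms_def f_hom)

lemma f_closed: "x \<in> carrier (K n) \<Longrightarrow> f n x \<in> carrier (L n)"
  using f_hom by (rule hom_in_carrier)

lemma f_cycles: "x \<in> K.cycles n \<Longrightarrow> f n x \<in> L.cycles n"
  using f_closed[of x n] f_d[of x n] group_hom.hom_one[OF f_group_hom, of "n - 1"]
  by (auto simp: kernel_def)

lemma f_boundaries: "f n ` K.boundaries n \<subseteq> L.boundaries n"
  using f_d[of _ "n + 1"] f_closed[of _ "n + 1"] by auto

text \<open>Available for every element of \<open>K n\<close>, cycle or not, because the boundaries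
  form a subgroup of all of \<open>K n\<close>.\<close>

lemma induced_class:
  assumes "x \<in> carrier (K n)"
  shows "induced n (K.homology_class n x) = L.homology_class n (f n x)"
  by (rule coset_map_r_coset[OF K.grp L.grp K.subgroup_boundaries L.subgroup_boundaries
        f_hom f_boundaries assms])

lemma induced_hom: "induced n \<in> hom (chain_homology K d n) (chain_homology L d' n)"
proof -
  \<comment> \<open>The quotients are formed inside the cycle groups, so \<open>f n\<close> is first
    seen as a map between these; the updated carriers then drop out of
    \<open>coset_map\<close>.\<close>
  have "f n \<in> hom (K n\<lparr>carrier := K.cycles n\<rparr>) (L n\<lparr>carrier := L.cycles n\<rparr>)"
    using f_cycles hom_mult[OF f_hom] by (auto simp: hom_def kernel_def)
  from coset_map_hom[OF K.normal_boundaries L.normal_boundaries this f_boundaries]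
  show ?thesis by (simp add: chain_homology_def coset_map_carrier_update)
qed

end

section \<open>Connecting homomorphism and exactness\<close>

locale chain_ses =
  K: chain_complex K dK + L: chain_complex L dL + M: chain_complex M dM +
  F: chain_map K dK L dL f + G: chain_map L dL M dM g
  for K :: "int \<Rightarrow> 'k monoid" and dK and L :: "int \<Rightarrow> 'l monoid" and dL
    and M :: "int \<Rightarrow> 'm monoid" and dM and f g +
  assumes f_inj: "inj_on (f n) (carrier (K n))"
    and f_image: "f n ` carrier (K n) = kernel (L n) (M n) (g n)"
    and g_surj: "g n ` carrier (L n) = carrier (M n)"
begin

text \<open>The snake construction as a relation: lift an element of \<open>c\<close> along
  \<open>g\<close>, apply \<open>dL\<close>, pull back along \<open>f\<close>. Allowing all lifts
  makes independence of choices the uniqueness obligation of \<open>THE\<close>, discharged by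
  \<open>lift_unique\<close>.\<close>

definition connecting :: "int \<Rightarrow> 'm set \<Rightarrow> 'k set" where
  "connecting n c = (THE b. \<exists>l\<in>carrier (L n). \<exists>k\<in>carrier (K (n - 1)).
     g n l \<in> c \<and> f (n - 1) k = dL n l \<and> b = K.homology_class (n - 1) k)"

lemma g_f: "k \<in> carrier (K n) \<Longrightarrow> g n (f n k) = \<one>\<^bsub>M n\<^esub>"
  using f_image[of n] by (auto simp: kernel_def)

lemma f_preimage:
  assumes "l \<in> carrier (L n)" "g n l = \<one>\<^bsub>M n\<^esub>"
  obtains k where "k \<in> carrier (K n)" "f n k = l"
  using f_image[of n] assms by (force simp: kernel_def)

lemma g_preimage:
  assumes "m \<in> carrier (M n)"
  obtains l where "l \<in> carrier (L n)" "g n l = m"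
  using g_surj[of n] assms by (metis imageE)

text \<open>Since \<open>f\<close> is injective one degree lower, triviality of
  \<open>dK n k\<close> can be tested after applying \<open>f\<close>.\<close>

lemma cycle_if_f_cycle:
  assumes "k \<in> carrier (K n)" "dL n (f n k) = \<one>\<^bsub>L (n - 1)\<^esub>"
  shows "k \<in> K.cycles n"
proof -
  have "f (n - 1) (dK n k) = f (n - 1) \<one>\<^bsub>K (n - 1)\<^esub>"
    using assms F.f_d group_hom.hom_one[OF F.f_group_hom] by simp
  then have "dK n k = \<one>\<^bsub>K (n - 1)\<^esub>"
    using assms K.d_closed f_inj[of "n - 1"] monoid.one_closed[OF group.is_monoid[OF K.grp]]
    by (meson inj_onD)
  then show ?thesis using assms by (simp add: kernel_def)
qed

text \<open>The first claim rests on \<open>dL\<close> squaring to zero, the second on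
  \<open>g\<close> being trivial on the image of \<open>f\<close>.\<close>

lemma cycle_if_lift:
  assumes "l \<in> carrier (L n)" "k \<in> carrier (K (n - 1))" "f (n - 1) k = dL n l"
  shows "k \<in> K.cycles (n - 1)" "g n l \<in> M.cycles n"
proof -
  have "dL (n - 1) (dL n l) = \<one>\<^bsub>L (n - 1 - 1)\<^esub>"
    using L.d_d[of l "n - 1"] assms(1) by simp
  then show "k \<in> K.cycles (n - 1)"
    by (intro cycle_if_f_cycle) (use assms in simp_all)
  have "dM n (g n l) = g (n - 1) (f (n - 1) k)" using assms G.f_d by simp
  then have "dM n (g n l) = \<one>\<^bsub>M (n - 1)\<^esub>" using g_f[OF assms(2)] by metis
  then show "g n l \<in> M.cycles n"
    using assms G.f_closed by (simp add: kernel_def)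
qed

lemma lift_exists:
  assumes "z \<in> M.cycles n"
  obtains l k where "l \<in> carrier (L n)" "g n l = z" "k \<in> carrier (K (n - 1))"
    "f (n - 1) k = dL n l"
proof -
  obtain l where l: "l \<in> carrier (L n)" "g n l = z"
    using g_preimage assms by (metis (no_types, lifting) kernel_def mem_Collect_eq)
  have "g (n - 1) (dL n l) = \<one>\<^bsub>M (n - 1)\<^esub>" using l assms G.f_d by (simp add: kernel_def)
  then show thesis
    using f_preimage L.d_closed[OF l(1)] l that by metis
qed

lemma lift_unique:
  assumes l: "l \<in> carrier (L n)" "l' \<in> carrier (L n)"
    and k: "k \<in> carrier (K (n - 1))" "k' \<in> carrier (K (n - 1))"
    and fk: "f (n - 1) k = dL n l" "f (n - 1) k' = dL n l'"
    and gl: "g n l' \<in> M.homology_class n (g n l)"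
  shows "K.homology_class (n - 1) k' = K.homology_class (n - 1) k"
proof -
  interpret Kn: group "K (n - 1)" by simp
  interpret Ln: group "L n" by simp
  interpret Ln': group "L (n - 1)" by simp
  interpret Mn: group "M n" by simp
  interpret gn: group_hom "L n" "M n" "g n" by (rule G.f_group_hom)
  interpret dn: group_hom "L n" "L (n - 1)" "dL n" by (rule L.d_group_hom)
  interpret fn: group_hom "K (n - 1)" "L (n - 1)" "f (n - 1)" by (rule F.f_group_hom)
  obtain m where m: "m \<in> carrier (M (n + 1))" "g n l' = dM (n + 1) m \<otimes>\<^bsub>M n\<^esub> g n l"
    using gl by (auto simp: r_coset_def)
  obtain l2 where l2: "l2 \<in> carrier (L (n + 1))" "g (n + 1) l2 = m" using g_preimage m(1) .
  \<comment> \<open>Correcting \<open>l\<close> by the boundary of a lift of \<open>m\<close> gives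
    it the same image under \<open>g\<close> as \<open>l'\<close> without changing
    \<open>dL n l\<close>. The quotient of \<open>l'\<close> by \<open>l3\<close> then comes from
    some \<open>k2\<close>, and \<open>dK n k2\<close> is the difference of \<open>k'\<close> and
    \<open>k\<close>.\<close>
  define l3 where "l3 = dL (n + 1) l2 \<otimes>\<^bsub>L n\<^esub> l"
  have b: "dL (n + 1) l2 \<in> carrier (L n)" using L.d_closed[OF l2(1)] by simp
  have l3: "l3 \<in> carrier (L n)" using b l by (simp add: l3_def)
  have "g n l3 = g n l'" using m l2 b l G.f_d[OF l2(1)] by (simp add: l3_def)
  then have "g n (l' \<otimes>\<^bsub>L n\<^esub> inv\<^bsub>L n\<^esub> l3) = \<one>\<^bsub>M n\<^esub>" using l l3 by simp
  then obtain k2 where k2: "k2 \<in> carrier (K n)" "f n k2 = l' \<otimes>\<^bsub>L n\<^esub> inv\<^bsub>L n\<^esub> l3"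
    using f_preimage l l3 by (metis Ln.inv_closed Ln.m_closed)
  have dk2: "dK n k2 \<in> carrier (K (n - 1))" using K.d_closed[OF k2(1)] .
  have "l' = f n k2 \<otimes>\<^bsub>L n\<^esub> l3" using k2 l l3 by (simp add: Ln.m_assoc)
  then have "dL n l' = dL n (f n k2) \<otimes>\<^bsub>L (n - 1)\<^esub> dL n l3"
    using dn.hom_mult[OF F.f_closed[OF k2(1)] l3] by metis
  also have "dL n l3 = dL n l"
    using b l L.d_d[OF l2(1)] by (simp add: l3_def)
  also have "dL n (f n k2) \<otimes>\<^bsub>L (n - 1)\<^esub> dL n l = f (n - 1) (dK n k2 \<otimes>\<^bsub>K (n - 1)\<^esub> k)"
    using F.f_d[OF k2(1)] fk k dk2 by simp
  finally have "k' = dK n k2 \<otimes>\<^bsub>K (n - 1)\<^esub> k"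
    using fk k dk2 f_inj[of "n - 1"] by (metis inj_onD Kn.m_closed)
  then have "k' \<in> K.homology_class (n - 1) k" using k2 by (auto simp: r_coset_def)
  then show ?thesis
    using Kn.repr_independence[OF _ k(1) K.subgroup_boundaries] by blast
qed

text \<open>Any lift computes the connecting map, so later proofs may use whichever pair
  \<open>l\<close>, \<open>k\<close> is at hand.\<close>

lemma connecting_class:
  assumes l: "l \<in> carrier (L n)" and k: "k \<in> carrier (K (n - 1))" and fk: "f (n - 1) k = dL n l"
  shows "connecting n (M.homology_class n (g n l)) = K.homology_class (n - 1) k"
  unfolding connecting_def
proof (rule the_equality)
  have "g n l \<in> M.homology_class n (g n l)"
    by (rule group.rcos_self[OF M.grp G.f_closed[OF l] M.subgroup_boundaries])
  then show "\<exists>l'\<in>carrier (L n). \<exists>k'\<in>carrier (K (n - 1)). g n l' \<in> M.homology_class n (g n l) \<and>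
      f (n - 1) k' = dL n l' \<and> K.homology_class (n - 1) k = K.homology_class (n - 1) k'"
    using assms by blast
qed (use lift_unique assms in blast)

lemma connecting_hom:
  "connecting n \<in> hom (chain_homology M dM n) (chain_homology K dK (n - 1))"
proof (rule homI)
  fix c assume "c \<in> carrier (chain_homology M dM n)"
  then obtain z where "z \<in> M.cycles n" "c = M.homology_class n z"
    by (auto simp: M.carrier_homology)
  then show "connecting n c \<in> carrier (chain_homology K dK (n - 1))"
    using lift_exists connecting_class cycle_if_lift(1) K.carrier_homology
    by (metis (no_types, lifting) image_eqI)
next
  fix c c' assume "c \<in> carrier (chain_homology M dM n)" "c' \<in> carrier (chain_homology M dM n)"
  then obtain z z' where z: "z \<in> M.cycles n" "z' \<in> M.cycles n"
    and c: "c = M.homology_class n z" "c' = M.homology_class n z'"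
    by (auto simp: M.carrier_homology)
  obtain l k where lk: "l \<in> carrier (L n)" "g n l = z" "k \<in> carrier (K (n - 1))"
    "f (n - 1) k = dL n l" using lift_exists[OF z(1)] .
  obtain l' k' where lk': "l' \<in> carrier (L n)" "g n l' = z'" "k' \<in> carrier (K (n - 1))"
    "f (n - 1) k' = dL n l'" using lift_exists[OF z(2)] .
  interpret Kn: group "K (n - 1)" by simp
  interpret Ln: group "L n" by simp
  \<comment> \<open>The product of two lifts is a lift of the product.\<close>
  have g: "g n (l \<otimes>\<^bsub>L n\<^esub> l') = z \<otimes>\<^bsub>M n\<^esub> z'"
    using hom_mult[OF G.f_hom] lk lk' by metis
  have fd: "f (n - 1) (k \<otimes>\<^bsub>K (n - 1)\<^esub> k') = dL n (l \<otimes>\<^bsub>L n\<^esub> l')"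
    using hom_mult[OF F.f_hom lk(3) lk'(3)] hom_mult[OF L.d_hom lk(1) lk'(1)] lk lk' by simp
  have "connecting n (M.homology_class n (z \<otimes>\<^bsub>M n\<^esub> z')) = K.homology_class (n - 1) (k \<otimes>\<^bsub>K (n - 1)\<^esub> k')"
    using connecting_class[OF Ln.m_closed[OF lk(1) lk'(1)] Kn.m_closed[OF lk(3) lk'(3)] fd] g by simp
  also have "\<dots> = connecting n c \<otimes>\<^bsub>chain_homology K dK (n - 1)\<^esub> connecting n c'"
    using K.mult_homology[of k "n - 1" k'] cycle_if_lift(1)[OF lk(1,3,4)] cycle_if_lift(1)[OF lk'(1,3,4)]
      connecting_class[OF lk(1,3,4)] connecting_class[OF lk'(1,3,4)] lk(2) lk'(2) c by simp
  finally show "connecting n (c \<otimes>\<^bsub>chain_homology M dM n\<^esub> c') =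
      connecting n c \<otimes>\<^bsub>chain_homology K dK (n - 1)\<^esub> connecting n c'"
    using M.mult_homology[OF z] c by simp
qed

lemma exact_at_middle:
  "kernel (chain_homology L dL n) (chain_homology M dM n) (G.induced n)
    = F.induced n ` carrier (chain_homology K dK n)"
proof (intro subset_antisym subsetI)
  fix c assume "c \<in> kernel (chain_homology L dL n) (chain_homology M dM n) (G.induced n)"
  then obtain l where l: "l \<in> L.cycles n" "c = L.homology_class n l"
    and "G.induced n (L.homology_class n l) = M.boundaries n"
    by (auto simp: kernel_def[of "chain_homology L dL n"] L.carrier_homology M.one_homology)
  moreover have lc: "l \<in> carrier (L n)" using l by (simp add: kernel_def)
  ultimately have "g n l \<in> M.boundaries n"
    using G.induced_class M.homology_class_eq_one_iff G.f_closed by metis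
  then obtain m where m: "m \<in> carrier (M (n + 1))" "g n l = dM (n + 1) m" by auto
  obtain l2 where l2: "l2 \<in> carrier (L (n + 1))" "g (n + 1) l2 = m" using g_preimage m(1) .
  interpret Ln: comm_group "L n" by (rule L.comm)
  interpret gn: group_hom "L n" "M n" "g n" by (rule G.f_group_hom)
  interpret dn: group_hom "L n" "L (n - 1)" "dL n" by (rule L.d_group_hom)
  have b: "dL (n + 1) l2 \<in> carrier (L n)" using L.d_closed[OF l2(1)] by simp
  have "g n (dL (n + 1) l2) = g n l" using m l2 G.f_d[OF l2(1)] by simp
  \<comment> \<open>\<open>l\<close> and the boundary of \<open>l2\<close> have the same image under
    \<open>g\<close>; dividing by that boundary moves \<open>l\<close> into the image of
    \<open>f\<close> within its homology class.\<close>
  then have "g n (inv\<^bsub>L n\<^esub> dL (n + 1) l2 \<otimes>\<^bsub>L n\<^esub> l) = \<one>\<^bsub>M n\<^esub>" using lc b by simp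
  then obtain k where k: "k \<in> carrier (K n)" "f n k = inv\<^bsub>L n\<^esub> dL (n + 1) l2 \<otimes>\<^bsub>L n\<^esub> l"
    using f_preimage lc b by (metis Ln.inv_closed Ln.m_closed)
  have "dL n (f n k) = \<one>\<^bsub>L (n - 1)\<^esub>"
    using k l lc b L.d_d[OF l2(1)] by (simp add: kernel_def)
  then have kc: "k \<in> K.cycles n" using cycle_if_f_cycle k by blast
  have "l = dL (n + 1) l2 \<otimes>\<^bsub>L n\<^esub> f n k" using k lc b by (simp flip: Ln.m_assoc)
  then have "l \<in> L.homology_class n (f n k)" using l2 by (auto simp: r_coset_def)
  then have "c = L.homology_class n (f n k)"
    using Ln.repr_independence[OF _ F.f_closed[OF k(1)] L.subgroup_boundaries] l by blast
  then show "c \<in> F.induced n ` carrier (chain_homology K dK n)"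
    using F.induced_class[OF k(1)] kc K.carrier_homology by (metis image_eqI)
next
  fix c assume "c \<in> F.induced n ` carrier (chain_homology K dK n)"
  then obtain k where k: "k \<in> K.cycles n" "c = F.induced n (K.homology_class n k)"
    by (auto simp: K.carrier_homology)
  then have kc: "k \<in> carrier (K n)" by (simp add: kernel_def)
  have c: "c = L.homology_class n (f n k)" using F.induced_class[OF kc] k by simp
  have "G.induced n c = M.homology_class n \<one>\<^bsub>M n\<^esub>"
    unfolding c using G.induced_class[OF F.f_closed[OF kc]] g_f[OF kc] by simp
  also have "\<dots> = M.boundaries n"
    by (simp add: M.homology_class_eq_one_iff group.is_monoid monoid.one_closed
        subgroup.one_closed[OF M.subgroup_boundaries])
  finally show "c \<in> kernel (chain_homology L dL n) (chain_homology M dM n) (G.induced n)"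
    using F.f_cycles[OF k(1)] c
    by (simp add: kernel_def[of "chain_homology L dL n"] L.carrier_homology M.one_homology)
qed

lemma exact_at_right:
  "kernel (chain_homology M dM n) (chain_homology K dK (n - 1)) (connecting n)
    = G.induced n ` carrier (chain_homology L dL n)"
proof (intro subset_antisym subsetI)
  fix c assume "c \<in> kernel (chain_homology M dM n) (chain_homology K dK (n - 1)) (connecting n)"
  then obtain z where z: "z \<in> M.cycles n" "c = M.homology_class n z"
    and cz: "connecting n (M.homology_class n z) = K.boundaries (n - 1)"
    by (auto simp: kernel_def[of "chain_homology M dM n"] M.carrier_homology K.one_homology)
  obtain l k where lk: "l \<in> carrier (L n)" "g n l = z" "k \<in> carrier (K (n - 1))"
    "f (n - 1) k = dL n l" using lift_exists[OF z(1)] .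
  have "K.homology_class (n - 1) k = K.boundaries (n - 1)"
    using connecting_class[OF lk(1,3,4)] cz lk(2) by simp
  then have "k \<in> K.boundaries (n - 1)" using K.homology_class_eq_one_iff lk by blast
  then obtain k1 where k1: "k1 \<in> carrier (K n)" "k = dK n k1" by auto
  interpret Ln: group "L n" by simp
  interpret Ln': group "L (n - 1)" by simp
  interpret gn: group_hom "L n" "M n" "g n" by (rule G.f_group_hom)
  interpret dn: group_hom "L n" "L (n - 1)" "dL n" by (rule L.d_group_hom)
  \<comment> \<open>From \<open>k = dK n k1\<close> follows \<open>dL n l = dL n (f n k1)\<close>.
    Dividing by \<open>f n k1\<close> thus turns \<open>l\<close> into a cycle and leaves its image
    under \<open>g\<close> unchanged.\<close>
  define l' where "l' = l \<otimes>\<^bsub>L n\<^esub> inv\<^bsub>L n\<^esub> f n k1"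
  note fk1 = F.f_closed[OF k1(1)]
  have "dL n l' = \<one>\<^bsub>L (n - 1)\<^esub>"
    using lk k1 fk1 F.f_d[OF k1(1)] by (simp add: l'_def)
  then have l': "l' \<in> L.cycles n" using lk fk1 by (simp add: kernel_def l'_def)
  have "g n l' = z" using lk fk1 g_f[OF k1(1)] by (auto simp add: l'_def)
  then have "G.induced n (L.homology_class n l') = c"
    using G.induced_class[of l' n] l' z by (simp add: kernel_def)
  then show "c \<in> G.induced n ` carrier (chain_homology L dL n)"
    using l' L.carrier_homology by (metis image_eqI)
next
  fix c assume "c \<in> G.induced n ` carrier (chain_homology L dL n)"
  then obtain l where l: "l \<in> L.cycles n" "c = G.induced n (L.homology_class n l)"
    by (auto simp: L.carrier_homology)
  then have lc: "l \<in> carrier (L n)" "dL n l = \<one>\<^bsub>L (n - 1)\<^esub>" by (auto simp: kernel_def)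
  have c: "c = M.homology_class n (g n l)" using G.induced_class[OF lc(1)] l by simp
  have one: "\<one>\<^bsub>K (n - 1)\<^esub> \<in> carrier (K (n - 1))"
    by (simp add: group.is_monoid monoid.one_closed)
  have "connecting n c = K.homology_class (n - 1) \<one>\<^bsub>K (n - 1)\<^esub>"
    unfolding c using group_hom.hom_one[OF F.f_group_hom] lc
    by (intro connecting_class one) auto
  \<comment> \<open>A cycle \<open>l\<close> has trivial boundary, so \<open>l\<close> together with
    the identity of \<open>K (n - 1)\<close> is a lift.\<close>
  also have "\<dots> = K.boundaries (n - 1)"
    using K.homology_class_eq_one_iff[OF one] subgroup.one_closed[OF K.subgroup_boundaries] by blast
  finally show "c \<in> kernel (chain_homology M dM n) (chain_homology K dK (n - 1)) (connecting n)"
    using G.f_cycles[OF l(1)] c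
    by (simp add: kernel_def[of "chain_homology M dM n"] M.carrier_homology K.one_homology)
qed

text \<open>That \<open>f (n - 1) k\<close> equals a boundary \<open>dL n l\<close> says precisely
  that \<open>l\<close> and \<open>k\<close> form a lift as in \<open>connecting_class\<close>; both
  inclusions follow. The degree \<open>n - 1\<close> matches the target of
  \<open>connecting n\<close>.\<close>

lemma exact_at_left:
  "kernel (chain_homology K dK (n - 1)) (chain_homology L dL (n - 1)) (F.induced (n - 1))
    = connecting n ` carrier (chain_homology M dM n)"
proof (intro subset_antisym subsetI)
  fix c assume "c \<in> kernel (chain_homology K dK (n - 1)) (chain_homology L dL (n - 1)) (F.induced (n - 1))"
  then obtain k where k: "k \<in> K.cycles (n - 1)" "c = K.homology_class (n - 1) k"
    and ck: "F.induced (n - 1) (K.homology_class (n - 1) k) = L.boundaries (n - 1)"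
    by (auto simp: kernel_def[of "chain_homology K dK (n - 1)"] K.carrier_homology L.one_homology)
  have kc: "k \<in> carrier (K (n - 1))" using k by (simp add: kernel_def)
  then have "f (n - 1) k \<in> L.boundaries (n - 1)"
    using ck F.induced_class L.homology_class_eq_one_iff F.f_closed by metis
  then obtain l where l: "l \<in> carrier (L n)" "f (n - 1) k = dL n l" by auto
  have "c = connecting n (M.homology_class n (g n l))"
    using connecting_class[OF l(1) kc l(2)] k by simp
  then show "c \<in> connecting n ` carrier (chain_homology M dM n)"
    using cycle_if_lift(2)[OF l(1) kc l(2)] M.carrier_homology by (metis image_eqI)
next
  fix c assume "c \<in> connecting n ` carrier (chain_homology M dM n)"
  then obtain z where z: "z \<in> M.cycles n" "c = connecting n (M.homology_class n z)"
    by (auto simp: M.carrier_homology)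
  obtain l k where lk: "l \<in> carrier (L n)" "g n l = z" "k \<in> carrier (K (n - 1))"
    "f (n - 1) k = dL n l" using lift_exists[OF z(1)] .
  have c: "c = K.homology_class (n - 1) k" using connecting_class[OF lk(1,3,4)] z lk by simp
  have "f (n - 1) k \<in> L.boundaries (n - 1)" using lk by simp
  then have "F.induced (n - 1) c = L.boundaries (n - 1)"
    unfolding c using F.induced_class[OF lk(3)] L.homology_class_eq_one_iff F.f_closed lk(3) by metis
  then show "c \<in> kernel (chain_homology K dK (n - 1)) (chain_homology L dL (n - 1)) (F.induced (n - 1))"
    using cycle_if_lift(1)[OF lk(1,3,4)] c
    by (simp add: kernel_def[of "chain_homology K dK (n - 1)"] K.carrier_homology L.one_homology)
qed

end

section \<open>Chain cones of cochain complexes\<close>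

lemma comm_group_hom_group:
  assumes C: "group C" and D: "comm_group D"
  shows "comm_group (hom_group C D)"
proof -
  interpret C: group C by fact
  interpret D: comm_group D by fact
  show ?thesis
  proof (rule comm_groupI)
    show "\<phi> \<otimes>\<^bsub>hom_group C D\<^esub> \<psi> \<in> carrier (hom_group C D)"
      if "\<phi> \<in> carrier (hom_group C D)" "\<psi> \<in> carrier (hom_group C D)" for \<phi> \<psi>
      using that by (auto simp: hom_group_def hom_def Pi_iff D.m_ac)
    show "\<one>\<^bsub>hom_group C D\<^esub> \<in> carrier (hom_group C D)"
      by (auto simp: hom_group_def hom_def)
    show "\<exists>\<psi>\<in>carrier (hom_group C D). \<psi> \<otimes>\<^bsub>hom_group C D\<^esub> \<phi> = \<one>\<^bsub>hom_group C D\<^esub>"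
      if "\<phi> \<in> carrier (hom_group C D)" for \<phi>
      by (rule bexI[where x = "\<lambda>c\<in>carrier C. inv\<^bsub>D\<^esub> \<phi> c"])
        (use that in \<open>auto simp: hom_group_def hom_def Pi_iff D.inv_mult fun_eq_iff\<close>)
  qed (auto simp: hom_group_def hom_def Pi_iff D.m_ac fun_eq_iff extensional_def)
qed

lemma hom_group_precompose:
  assumes "group C" "h \<in> hom C C'"
  shows "(\<lambda>\<phi>. \<lambda>c\<in>carrier C. \<phi> (h c)) \<in> hom (hom_group C' D) (hom_group C D)"
proof -
  interpret C: group C by fact
  show ?thesis
    using assms by (auto simp: hom_group_def hom_def Pi_iff fun_eq_iff)
qed

lemma hom_group_precompose_inj:
  assumes "q ` carrier B = carrier C"
  shows "inj_on (\<lambda>\<phi>. \<lambda>c\<in>carrier B. \<phi> (q c)) (carrier (hom_group C D))"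
proof (rule inj_onI)
  fix \<phi> \<psi> assume \<phi>: "\<phi> \<in> carrier (hom_group C D)" and \<psi>: "\<psi> \<in> carrier (hom_group C D)"
    and eq: "(\<lambda>c\<in>carrier B. \<phi> (q c)) = (\<lambda>c\<in>carrier B. \<psi> (q c))"
  have "\<phi> c = \<psi> c" if "c \<in> carrier C" for c
  proof -
    have "c \<in> q ` carrier B" using that assms by simp
    then obtain b where b: "b \<in> carrier B" "c = q b" by blast
    then show ?thesis using fun_cong[OF eq, of b] by simp
  qed
  then show "\<phi> = \<psi>" using \<phi> \<psi> by (auto simp: hom_group_def intro: extensionalityI)
qed

text \<open>Left exactness, for an arbitrary group \<open>D\<close>: a homomorphism trivial on the
  kernel of \<open>q\<close> is constant on the fibres of \<open>q\<close> and so descends to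
  \<open>C\<close>.\<close>

lemma hom_group_precompose_exact:
  assumes A: "group A" and B: "group B" and C: "group C" and D: "group D"
    and p: "p \<in> hom A B" and q: "q \<in> hom B C"
    and ex: "p ` carrier A = kernel B C q" and qs: "q ` carrier B = carrier C"
  shows "(\<lambda>\<phi>. \<lambda>c\<in>carrier B. \<phi> (q c)) ` carrier (hom_group C D)
    = kernel (hom_group B D) (hom_group A D) (\<lambda>\<phi>. \<lambda>c\<in>carrier A. \<phi> (p c))"
proof (intro subset_antisym subsetI)
  fix \<psi> assume "\<psi> \<in> (\<lambda>\<phi>. \<lambda>c\<in>carrier B. \<phi> (q c)) ` carrier (hom_group C D)"
  then obtain \<phi> where \<phi>: "\<phi> \<in> carrier (hom_group C D)" "\<psi> = (\<lambda>c\<in>carrier B. \<phi> (q c))" by blast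
  have "\<phi> (q (p a)) = \<one>\<^bsub>D\<^esub>" if a: "a \<in> carrier A" for a
  proof -
    have "q (p a) = \<one>\<^bsub>C\<^esub>" using ex a by (auto simp: kernel_def)
    then show ?thesis using hom_one[OF _ C D, of \<phi>] \<phi> by (simp add: hom_group_def)
  qed
  then show "\<psi> \<in> kernel (hom_group B D) (hom_group A D) (\<lambda>\<phi>. \<lambda>c\<in>carrier A. \<phi> (p c))"
    using hom_in_carrier[OF hom_group_precompose[OF B q] \<phi>(1)] \<phi>(2) hom_in_carrier[OF p]
    by (auto simp: kernel_def hom_group_def intro!: restrict_ext)
next
  fix \<psi> assume "\<psi> \<in> kernel (hom_group B D) (hom_group A D) (\<lambda>\<phi>. \<lambda>c\<in>carrier A. \<phi> (p c))"
  then have \<psi>: "\<psi> \<in> hom B D" "\<psi> \<in> extensional (carrier B)"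
    and "(\<lambda>c\<in>carrier A. \<psi> (p c)) = (\<lambda>c\<in>carrier A. \<one>\<^bsub>D\<^esub>)"
    by (auto simp: kernel_def hom_group_def)
  then have "\<psi> (p a) = \<one>\<^bsub>D\<^esub>" if "a \<in> carrier A" for a
    using that by (metis restrict_apply')
  then have ker: "\<psi> b = \<one>\<^bsub>D\<^esub>" if "b \<in> kernel B C q" for b
    using that ex by (metis imageE)
  interpret B: group B by fact
  interpret D: group D by fact
  interpret q: group_hom B C q using B C q by (simp add: group_hom_def group_hom_axioms_def)
  interpret \<psi>: group_hom B D \<psi> using B D \<psi> by (simp add: group_hom_def group_hom_axioms_def)
  have wd: "\<psi> b = \<psi> b'" if b: "b \<in> carrier B" "b' \<in> carrier B" "q b = q b'" for b b'
  proof -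
    have "\<psi> (b \<otimes>\<^bsub>B\<^esub> inv\<^bsub>B\<^esub> b') = \<one>\<^bsub>D\<^esub>" using b by (intro ker) (simp add: kernel_def)
    then have "\<psi> b \<otimes>\<^bsub>D\<^esub> inv\<^bsub>D\<^esub> \<psi> b' = \<one>\<^bsub>D\<^esub>" using b by simp
    then show ?thesis
      using b by (metis D.inv_equality D.inv_inv D.inv_closed \<psi>.hom_closed)
  qed
  \<comment> \<open>\<open>s\<close> is only a set-theoretic section. By \<open>wd\<close> the
    choice of preimages does not affect \<open>\<psi>\<close>, which makes \<open>\<phi>\<close>
    multiplicative below.\<close>
  define s where "s = inv_into (carrier B) q"
  have s: "s c \<in> carrier B" "q (s c) = c" if "c \<in> carrier C" for c
    using that qs inv_into_into f_inv_into_f unfolding s_def by metis+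
  define \<phi> where "\<phi> = (\<lambda>c\<in>carrier C. \<psi> (s c))"
  have \<phi>q: "\<phi> (q b) = \<psi> b" if "b \<in> carrier B" for b
    using that s[of "q b"] by (auto simp: \<phi>_def intro: wd)
  have "\<phi> \<in> hom C D"
  proof (rule homI)
    show "\<phi> c \<in> carrier D" if "c \<in> carrier C" for c using that s by (simp add: \<phi>_def)
    show "\<phi> (c \<otimes>\<^bsub>C\<^esub> c') = \<phi> c \<otimes>\<^bsub>D\<^esub> \<phi> c'" if c: "c \<in> carrier C" "c' \<in> carrier C" for c c'
      using \<phi>q[of "s c \<otimes>\<^bsub>B\<^esub> s c'"] \<phi>q[of "s c"] \<phi>q[of "s c'"] s c by simp
  qed
  then have "\<phi> \<in> carrier (hom_group C D)" by (simp add: hom_group_def \<phi>_def)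
  moreover have "\<psi> = (\<lambda>c\<in>carrier B. \<phi> (q c))"
    using \<psi>(2) \<phi>q by (auto intro: extensionalityI)
  ultimately show "\<psi> \<in> (\<lambda>\<phi>. \<lambda>c\<in>carrier B. \<phi> (q c)) ` carrier (hom_group C D)" by blast
qed

text \<open>Here the extension property of injective groups enters. It is taken in the form valid
  over arbitrary types, as \<open>A\<close> and \<open>B\<close> will be groups of cosets of
  cochains.\<close>

lemma hom_group_precompose_surj:
  assumes A: "comm_group A" and B: "comm_group B" and D: "injective_group D"
    and p: "p \<in> mon A B"
  shows "(\<lambda>\<phi>. \<lambda>c\<in>carrier A. \<phi> (p c)) ` carrier (hom_group B D) = carrier (hom_group A D)"
proof (intro subset_antisym subsetI)
  fix \<phi> assume "\<phi> \<in> (\<lambda>\<phi>. \<lambda>c\<in>carrier A. \<phi> (p c)) ` carrier (hom_group B D)"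
  moreover have "group A" "p \<in> hom A B" using A p by (auto simp: comm_group_def mon_def)
  ultimately show "\<phi> \<in> carrier (hom_group A D)"
    using hom_in_carrier[OF hom_group_precompose] by blast
next
  fix \<phi> assume \<phi>: "\<phi> \<in> carrier (hom_group A D)"
  then obtain k where k: "k \<in> hom B D" "\<And>a. a \<in> carrier A \<Longrightarrow> k (p a) = \<phi> a"
    using injective_group_extend[OF D A B p, of \<phi>] by (auto simp: hom_group_def)
  have pc: "p a \<in> carrier B" if "a \<in> carrier A" for a
    using that p by (auto simp: mon_def dest: hom_in_carrier)
  \<comment> \<open>The extension is cut off outside \<open>carrier B\<close> because elements of
    \<open>hom_group\<close> are extensional.\<close>
  have "\<phi> = (\<lambda>c\<in>carrier A. restrict k (carrier B) (p c))"
    using \<phi> k(2) pc by (auto simp: hom_group_def intro: extensionalityI)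
  moreover have "restrict k (carrier B) \<in> carrier (hom_group B D)"
    using k(1) B by (auto simp: hom_group_def hom_def Pi_iff comm_group_def group.is_monoid monoid.m_closed)
  ultimately show "\<phi> \<in> (\<lambda>\<phi>. \<lambda>c\<in>carrier A. \<phi> (p c)) ` carrier (hom_group B D)" by blast
qed

lemma comm_group_DirProd:
  assumes "comm_group G" "comm_group H"
  shows "comm_group (G \<times>\<times> H)"
proof -
  interpret G: comm_group G by fact
  interpret H: comm_group H by fact
  show ?thesis
    by (rule group.group_comm_groupI[OF DirProd_group])
      (auto simp: G.is_group H.is_group G.m_comm H.m_comm)
qed

section \<open>Cones, contravariant in the cochain complex\<close>

locale cochain_complex =
  fixes C :: "int \<Rightarrow> 'c monoid" and \<delta> :: "int \<Rightarrow> 'c \<Rightarrow> 'c"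
  assumes comm: "comm_group (C n)"
    and \<delta>_hom: "\<delta> n \<in> hom (C n) (C (n + 1))"
    and \<delta>_\<delta>: "x \<in> carrier (C n) \<Longrightarrow> \<delta> (n + 1) (\<delta> n x) = \<one>\<^bsub>C (n + 2)\<^esub>"
begin

lemma grp [simp]: "group (C n)"
  using comm by (rule comm_group.axioms)

lemma \<delta>_closed: "x \<in> carrier (C n) \<Longrightarrow> \<delta> n x \<in> carrier (C (n + 1))"
  using \<delta>_hom by (rule hom_in_carrier)

text \<open>In the second component of the squared boundary the two terms containing
  \<open>\<beta>\<close> cancel, thanks to the minus sign in the cone. All other terms contain two
  successive coboundaries.\<close>

lemma chain_complex_cone:
  assumes G': "comm_group G'" and G'': "comm_group G''" and \<beta>: "\<beta> \<in> hom G' G''"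
  shows "chain_complex (cone_group C G' G'') (cone_boundary C \<delta> \<beta> G'')"
proof -
  interpret G': comm_group G' by fact
  interpret G'': comm_group G'' by fact
  interpret \<beta>: group_hom G' G'' \<beta> using \<beta> by unfold_locales
  interpret C: group "C n" for n by simp
  \<comment> \<open>The boundary in degree \<open>n\<close> uses the coboundary in degree
    \<open>n - 1\<close>; its target index \<open>n - 1 + 1\<close> is normalised to
    \<open>n\<close> here.\<close>
  have \<delta>m: "\<delta> (n - 1) (x \<otimes>\<^bsub>C (n - 1)\<^esub> y) = \<delta> (n - 1) x \<otimes>\<^bsub>C n\<^esub> \<delta> (n - 1) y"
    if "x \<in> carrier (C (n - 1))" "y \<in> carrier (C (n - 1))" for x y n
    using hom_mult[OF \<delta>_hom that] by simp
  have \<delta>c: "\<delta> (n - 1) x \<in> carrier (C n)" if "x \<in> carrier (C (n - 1))" for x n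
    using \<delta>_closed[OF that] by simp
  note \<delta>m' = hom_mult[OF \<delta>_hom]
  show ?thesis
  proof (rule chain_complex.intro)
    show "comm_group (cone_group C G' G'' n)" for n
      unfolding cone_group_def by (intro comm_group_DirProd comm_group_hom_group grp G' G'')
    show "cone_boundary C \<delta> \<beta> G'' n \<in> hom (cone_group C G' G'' n) (cone_group C G' G'' (n - 1))" for n
    proof (rule homI)
      fix x assume "x \<in> carrier (cone_group C G' G'' n)"
      then show "cone_boundary C \<delta> \<beta> G'' n x \<in> carrier (cone_group C G' G'' (n - 1))"
        by (auto simp: cone_group_def cone_boundary_def hom_group_def hom_def Pi_iff \<delta>m \<delta>c
            \<delta>m' \<delta>_closed G''.inv_mult G''.m_ac)
    next
      fix x y assume "x \<in> carrier (cone_group C G' G'' n)" "y \<in> carrier (cone_group C G' G'' n)"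
      then show "cone_boundary C \<delta> \<beta> G'' n (x \<otimes>\<^bsub>cone_group C G' G'' n\<^esub> y) =
          cone_boundary C \<delta> \<beta> G'' n x \<otimes>\<^bsub>cone_group C G' G'' (n - 1)\<^esub> cone_boundary C \<delta> \<beta> G'' n y"
        by (auto simp: cone_group_def cone_boundary_def hom_group_def hom_def Pi_iff \<delta>c
            \<delta>_closed G''.inv_mult G''.m_ac fun_eq_iff)
    qed
    show "cone_boundary C \<delta> \<beta> G'' n (cone_boundary C \<delta> \<beta> G'' (n + 1) x) = \<one>\<^bsub>cone_group C G' G'' (n - 1)\<^esub>"
      if "x \<in> carrier (cone_group C G' G'' (n + 1))" for n x
    proof -
      obtain \<phi>' \<phi>'' where x: "x = (\<phi>', \<phi>'')" by (cases x)
      have \<phi>': "\<phi>' \<in> hom (C (n + 1)) G'" and \<phi>'': "\<phi>'' \<in> hom (C (n + 2)) G''"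
        using that by (auto simp: x cone_group_def hom_group_def add.commute[of n 2])
      have "\<phi>' (\<delta> n (\<delta> (n - 1) c)) = \<one>\<^bsub>G'\<^esub>" if "c \<in> carrier (C (n - 1))" for c
        using hom_one[OF \<phi>'] \<delta>_\<delta>[OF that] by (simp add: add.commute[of n 1])
      moreover have "\<phi>'' (\<delta> (n + 1) (\<delta> n c)) = \<one>\<^bsub>G''\<^esub>" if "c \<in> carrier (C n)" for c
        using hom_one[OF \<phi>''] \<delta>_\<delta>[OF that] by simp
      moreover have "\<beta> (\<phi>' (\<delta> n c)) \<in> carrier G''" if "c \<in> carrier (C n)" for c
        using that \<delta>_closed hom_in_carrier[OF \<phi>'] by simp
      ultimately show ?thesis
        by (auto simp: x cone_group_def cone_boundary_def hom_group_def fun_eq_iff \<delta>c \<delta>_closed)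
    qed
  qed
qed

end

text \<open>The source complex is an argument because precomposed homomorphisms must be restricted
  to its carriers to be extensional.\<close>

definition cone_map ::
  "(int \<Rightarrow> 'c monoid) \<Rightarrow> (int \<Rightarrow> 'c \<Rightarrow> 'b) \<Rightarrow> int \<Rightarrow> ('b \<Rightarrow> 'd) \<times> ('b \<Rightarrow> 'e) \<Rightarrow> ('c \<Rightarrow> 'd) \<times> ('c \<Rightarrow> 'e)"
  where "cone_map C p n = (\<lambda>(\<phi>', \<phi>'').
     (\<lambda>c\<in>carrier (C n). \<phi>' (p n c), \<lambda>c\<in>carrier (C (n + 1)). \<phi>'' (p (n + 1) c)))"

text \<open>In this form injectivity and images are inherited from the two Hom factors.\<close>

lemma cone_map_eq:
  "cone_map C p n = map_prod (\<lambda>\<phi>. \<lambda>c\<in>carrier (C n). \<phi> (p n c))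
     (\<lambda>\<phi>. \<lambda>c\<in>carrier (C (n + 1)). \<phi> (p (n + 1) c))"
  by (auto simp: cone_map_def fun_eq_iff)

lemma chain_map_cone_map:
  assumes C: "cochain_complex C \<delta>" and D: "cochain_complex D \<epsilon>"
    and p: "\<And>n. p n \<in> hom (C n) (D n)"
    and p\<delta>: "\<And>n c. c \<in> carrier (C n) \<Longrightarrow> p (n + 1) (\<delta> n c) = \<epsilon> n (p n c)"
    and G': "comm_group G'" and G'': "comm_group G''" and \<beta>: "\<beta> \<in> hom G' G''"
  shows "chain_map (cone_group D G' G'') (cone_boundary D \<epsilon> \<beta> G'')
    (cone_group C G' G'') (cone_boundary C \<delta> \<beta> G'') (cone_map C p)"
proof -
  interpret C: cochain_complex C \<delta> by fact
  interpret D: cochain_complex D \<epsilon> by fact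
  interpret K: chain_complex "cone_group D G' G''" "cone_boundary D \<epsilon> \<beta> G''"
    by (rule D.chain_complex_cone[OF G' G'' \<beta>])
  interpret L: chain_complex "cone_group C G' G''" "cone_boundary C \<delta> \<beta> G''"
    by (rule C.chain_complex_cone[OF G' G'' \<beta>])
  show ?thesis
  proof
    show "cone_map C p n \<in> hom (cone_group D G' G'' n) (cone_group C G' G'' n)" for n
    proof -
      have "group (hom_group (D m) G')" "group (hom_group (D m) G'')" for m
        using comm_group_hom_group[OF D.grp] G' G'' by (auto simp: comm_group_def)
      then show ?thesis
        unfolding cone_map_def cone_group_def
        by (simp add: hom_paired2 hom_group_precompose p)
    qed
    show "cone_map C p (n - 1) (cone_boundary D \<epsilon> \<beta> G'' n x) = cone_boundary C \<delta> \<beta> G'' n (cone_map C p n x)"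
      for n x
    proof -
      have "p n (\<delta> (n - 1) c) = \<epsilon> (n - 1) (p (n - 1) c)" if "c \<in> carrier (C (n - 1))" for c
        using p\<delta>[OF that] by simp
      moreover have "\<delta> (n - 1) c \<in> carrier (C n)" if "c \<in> carrier (C (n - 1))" for c
        using C.\<delta>_closed[OF that] by simp
      ultimately show ?thesis
        using p\<delta>[of _ n] hom_in_carrier[OF p] C.\<delta>_closed
        by (cases x) (auto simp: cone_map_def cone_boundary_def intro!: restrict_ext)
    qed
  qed
qed

text \<open>Surjectivity of \<open>q\<close> makes the map of cones injective, and extension along
  \<open>p\<close> makes the other one surjective. Both are used in degree \<open>n\<close> with
  \<open>G'\<close> and in degree \<open>n + 1\<close> with \<open>G''\<close>.\<close>

theorem chain_ses_cone_map:
  assumes C: "cochain_complex C1 \<delta>1" "cochain_complex C2 \<delta>2" "cochain_complex C3 \<delta>3"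
    and p: "\<And>n. p n \<in> mon (C1 n) (C2 n)" and q: "\<And>n. q n \<in> epi (C2 n) (C3 n)"
    and ex: "\<And>n. p n ` carrier (C1 n) = kernel (C2 n) (C3 n) (q n)"
    and p\<delta>: "\<And>n c. c \<in> carrier (C1 n) \<Longrightarrow> p (n + 1) (\<delta>1 n c) = \<delta>2 n (p n c)"
    and q\<delta>: "\<And>n c. c \<in> carrier (C2 n) \<Longrightarrow> q (n + 1) (\<delta>2 n c) = \<delta>3 n (q n c)"
    and G': "injective_group G'" and G'': "injective_group G''" and \<beta>: "\<beta> \<in> hom G' G''"
  shows "chain_ses (cone_group C3 G' G'') (cone_boundary C3 \<delta>3 \<beta> G'')
    (cone_group C2 G' G'') (cone_boundary C2 \<delta>2 \<beta> G'')
    (cone_group C1 G' G'') (cone_boundary C1 \<delta>1 \<beta> G'') (cone_map C2 q) (cone_map C1 p)"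
proof -
  interpret C1: cochain_complex C1 \<delta>1 by fact
  interpret C2: cochain_complex C2 \<delta>2 by fact
  interpret C3: cochain_complex C3 \<delta>3 by fact
  have cg: "comm_group G'" "comm_group G''" using G' G'' by (auto simp: injective_group_def)
  have gr: "group G'" "group G''" using cg by (auto simp: comm_group_def)
  have ph: "p n \<in> hom (C1 n) (C2 n)" for n using p[of n] by (simp add: mon_def)
  have qh: "q n \<in> hom (C2 n) (C3 n)" and qs: "q n ` carrier (C2 n) = carrier (C3 n)" for n
    using q[of n] by (auto simp: epi_def)
  interpret F: chain_map "cone_group C3 G' G''" "cone_boundary C3 \<delta>3 \<beta> G''"
    "cone_group C2 G' G''" "cone_boundary C2 \<delta>2 \<beta> G''" "cone_map C2 q"
    by (rule chain_map_cone_map[OF C(2,3) qh q\<delta> cg \<beta>])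
  interpret G: chain_map "cone_group C2 G' G''" "cone_boundary C2 \<delta>2 \<beta> G''"
    "cone_group C1 G' G''" "cone_boundary C1 \<delta>1 \<beta> G''" "cone_map C1 p"
    by (rule chain_map_cone_map[OF C(1,2) ph p\<delta> cg \<beta>])
  note exact = hom_group_precompose_exact[OF C1.grp C2.grp C3.grp _ ph qh ex qs]
  note surj = hom_group_precompose_surj[OF C1.comm C2.comm _ p]
  show ?thesis
  proof
    show "inj_on (cone_map C2 q n) (carrier (cone_group C3 G' G'' n))" for n
      unfolding cone_map_eq cone_group_def carrier_DirProd
      by (intro map_prod_inj_on hom_group_precompose_inj qs)
    show "cone_map C2 q n ` carrier (cone_group C3 G' G'' n) =
        kernel (cone_group C2 G' G'' n) (cone_group C1 G' G'' n) (cone_map C1 p n)" for n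
    proof -
      have "cone_map C2 q n ` carrier (cone_group C3 G' G'' n) =
          kernel (hom_group (C2 n) G') (hom_group (C1 n) G') (\<lambda>\<phi>. \<lambda>c\<in>carrier (C1 n). \<phi> (p n c)) \<times>
          kernel (hom_group (C2 (n + 1)) G'') (hom_group (C1 (n + 1)) G'')
            (\<lambda>\<phi>. \<lambda>c\<in>carrier (C1 (n + 1)). \<phi> (p (n + 1) c))"
        unfolding cone_map_eq cone_group_def carrier_DirProd
        by (simp only: map_prod_surj_on[OF exact[OF gr(1)] exact[OF gr(2)]])
      \<comment> \<open>The identity of the cone is the pair of identities, so a product of kernels
        is the kernel of the product map.\<close>
      then show ?thesis by (auto simp: kernel_def cone_map_def cone_group_def)
    qed
    show "cone_map C1 p n ` carrier (cone_group C2 G' G'' n) = carrier (cone_group C1 G' G'' n)" for n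
      unfolding cone_map_eq cone_group_def carrier_DirProd
      by (intro map_prod_surj_on surj G' G'')
  qed
qed

section \<open>Normal cochains\<close>

lemma tuples_empty [simp]: "tuples n {} = {}"
  by (auto simp: tuples_def)

lemma tuples_mono: "S \<subseteq> T \<Longrightarrow> tuples n S \<subseteq> tuples n T"
  by (auto simp: tuples_def)

lemma tuples_Int: "tuples n (S \<inter> T) = tuples n S \<inter> tuples n T"
  by (auto simp: tuples_def)

text \<open>For \<open>0 \<le> n\<close> the tuple has at least two entries, so deleting one cannot
  produce the excluded empty list.\<close>

lemma tuples_delete:
  assumes "xs \<in> tuples (n + 1) S" "0 \<le> n" "i < length xs"
  shows "take i xs @ drop (Suc i) xs \<in> tuples n S"
proof -
  have "int (length xs) = n + 2" using assms(1) by (simp add: tuples_def)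
  then have len: "int (length (take i xs @ drop (Suc i) xs)) = n + 1"
    using assms(3) by (simp add: of_nat_diff)
  then have "take i xs @ drop (Suc i) xs \<noteq> []" using assms(2) by auto
  moreover have "set (take i xs @ drop (Suc i) xs) \<subseteq> S"
    using assms(1) set_take_subset[of i xs] set_drop_subset[of "Suc i" xs] by (auto simp: tuples_def)
  ultimately show ?thesis using len by (simp add: tuples_def)
qed

lemma delete_delete:
  assumes "j < i" "i < length xs"
  shows "take j (take i xs @ drop (Suc i) xs) @ drop (Suc j) (take i xs @ drop (Suc i) xs) =
    take (i - 1) (take j xs @ drop (Suc j) xs) @ drop (Suc (i - 1)) (take j xs @ drop (Suc j) xs)"
proof -
  obtain k where "i = Suc (j + k)" using assms(1) less_iff_Suc_add by blast
  then show ?thesis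
    using assms(2) by (intro nth_equalityI) (auto simp: nth_append min_def)
qed

text \<open>Deleting the \<open>i\<close>-th and then the \<open>j\<close>-th entry, \<open>j < i\<close>, is the same as deleting the \<open>j\<close>-th and
  then the \<open>(i - 1)\<close>-st one; the two occur with opposite signs, so that the double sum equals its
  own negative.\<close>

lemma alternating_delete_delete_sum:
  fixes \<phi> :: "'a list \<Rightarrow> int"
  defines "del \<equiv> \<lambda>i (xs :: 'a list). take i xs @ drop (Suc i) xs"
  shows "(\<Sum>i<length xs. (-1) ^ i * (\<Sum>j<length xs - 1. (-1) ^ j * \<phi> (del j (del i xs)))) = 0"
proof -
  let ?m = "length xs"
  let ?S = "\<lambda>(i, j). (-1) ^ (i + j) * \<phi> (del j (del i xs))"
  have dd: "del j (del i xs) = del (i - 1) (del j xs)" if "j < i" "i < ?m" for i j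
    using delete_delete[OF that] by (simp add: del_def)
  \<comment> \<open>\<open>t\<close> exchanges the two orders of deletion. The second index counts
    positions after the first deletion, whence the shift by one; the shift changes the parity of
    \<open>i + j\<close>, and \<open>t\<close> is an involution.\<close>
  define t where "t = (\<lambda>(i, j). if j < i then (j, i - 1) else (Suc j, i :: nat))"
  have "(\<Sum>i<?m. (-1) ^ i * (\<Sum>j<?m - 1. (-1) ^ j * \<phi> (del j (del i xs)))) =
      (\<Sum>p\<in>{..<?m} \<times> {..<?m - 1}. ?S p)" (is "?s = _")
    by (simp add: sum.cartesian_product[symmetric] sum_distrib_left power_add mult.assoc)
  also have "\<dots> = (\<Sum>p\<in>{..<?m} \<times> {..<?m - 1}. - ?S p)"
  proof (rule sum.reindex_bij_witness[of _ t t])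
    fix p assume "p \<in> {..<?m} \<times> {..<?m - 1}"
    then obtain i j where p: "p = (i, j)" "i < ?m" "j < ?m - 1" by auto
    then show "t (t p) = p" "t p \<in> {..<?m} \<times> {..<?m - 1}" "t (t p) = p"
      "t p \<in> {..<?m} \<times> {..<?m - 1}"
      by (auto simp: t_def)
    show "- ?S (t p) = ?S p"
    proof (cases "j < i")
      case True
      then obtain k where "i = Suc k" by (cases i) auto
      then show ?thesis using dd[of j i] p True by (simp add: t_def add.commute)
    next
      case False
      then show ?thesis using dd[of i "Suc j"] p by (simp add: t_def add.commute)
    qed
  qed
  also have "\<dots> = - ?s"
    by (simp add: sum_negf sum.cartesian_product[symmetric] sum_distrib_left power_add mult.assoc)
  finally show ?thesis by simp
qed

section \<open>Cochain groups modulo locally zero cochains\<close>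

lemma comm_group_cochain_group [simp]: "comm_group (cochain_group n X)"
  by (rule group.group_comm_groupI)
    (auto simp: cochain_group_def PiE_def add.commute intro!: restrict_ext)

lemma group_cochain_group [simp]: "group (cochain_group n X)"
  using comm_group_cochain_group by (rule comm_group.axioms)

lemma carrier_cochain_group: "carrier (cochain_group n X) = extensional (tuples n (topspace X))"
  by (auto simp: cochain_group_def PiE_def)

lemma mult_cochain_group:
  "\<phi> \<otimes>\<^bsub>cochain_group n X\<^esub> \<psi> = (\<lambda>xs\<in>tuples n (topspace X). \<phi> xs + \<psi> xs)"
  by (simp add: cochain_group_def)

lemma one_cochain_group: "\<one>\<^bsub>cochain_group n X\<^esub> = (\<lambda>xs\<in>tuples n (topspace X). 0)"
  by (simp add: cochain_group_def)

lemma inv_cochain_group: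
  assumes "\<phi> \<in> carrier (cochain_group n X)"
  shows "inv\<^bsub>cochain_group n X\<^esub> \<phi> = (\<lambda>xs\<in>tuples n (topspace X). - \<phi> xs)"
  using inv_product_group[of \<phi> "tuples n (topspace X)" "\<lambda>_. integer_group"] assms
  by (simp add: cochain_group_def)

lemma tuples_normal_covering:
  assumes "normal_covering X \<U>" "U \<in> \<U>"
  shows "tuples n U \<subseteq> tuples n (topspace X)"
  using assms by (intro tuples_mono) (auto simp: normal_covering_def)

lemma locally_zeroI:
  assumes "\<phi> \<in> extensional (tuples n (topspace X))" "normal_covering X \<U>"
    and "\<And>U xs. U \<in> \<U> \<Longrightarrow> xs \<in> tuples n U \<Longrightarrow> \<phi> xs = 0"
  shows "\<phi> \<in> locally_zero n X"
  using assms by (auto simp: locally_zero_def carrier_cochain_group)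

lemma locally_zeroD:
  assumes "\<phi> \<in> locally_zero n X"
  shows "\<exists>\<U>. normal_covering X \<U> \<and> (\<forall>U\<in>\<U>. \<forall>xs\<in>tuples n U. \<phi> xs = 0)"
  using assms by (auto simp: locally_zero_def)

lemma subgroup_locally_zero: "subgroup (locally_zero n X) (cochain_group n X)"
proof (rule group.subgroupI)
  show "locally_zero n X \<subseteq> carrier (cochain_group n X)" by (auto simp: locally_zero_def)
  have "(\<lambda>xs\<in>tuples n (topspace X). 0) \<in> locally_zero n X"
    by (rule locally_zeroI[OF _ normal_covering_topspace]) auto
  then show "locally_zero n X \<noteq> {}" by blast
next
  fix \<phi> assume \<phi>: "\<phi> \<in> locally_zero n X"
  obtain \<U> where U: "normal_covering X \<U>" "\<And>U xs. U \<in> \<U> \<Longrightarrow> xs \<in> tuples n U \<Longrightarrow> \<phi> xs = 0"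
    using locally_zeroD[OF \<phi>] by blast
  have "(\<lambda>xs\<in>tuples n (topspace X). - \<phi> xs) \<in> locally_zero n X"
    using U(2) subsetD[OF tuples_normal_covering[OF U(1)]]
    by (intro locally_zeroI[OF _ U(1)]) auto
  then show "inv\<^bsub>cochain_group n X\<^esub> \<phi> \<in> locally_zero n X"
    using inv_cochain_group[of \<phi> n X] \<phi> by (simp add: locally_zero_def)
next
  fix \<phi> \<psi> assume \<phi>: "\<phi> \<in> locally_zero n X" and \<psi>: "\<psi> \<in> locally_zero n X"
  obtain \<U> where U: "normal_covering X \<U>" "\<And>U xs. U \<in> \<U> \<Longrightarrow> xs \<in> tuples n U \<Longrightarrow> \<phi> xs = 0"
    using locally_zeroD[OF \<phi>] by blast
  obtain \<V> where V: "normal_covering X \<V>" "\<And>U xs. U \<in> \<V> \<Longrightarrow> xs \<in> tuples n U \<Longrightarrow> \<psi> xs = 0"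
    using locally_zeroD[OF \<psi>] by blast
  \<comment> \<open>A tuple in an intersection lies in a member of each covering, so both summands
    vanish on the common refinement.\<close>
  show "\<phi> \<otimes>\<^bsub>cochain_group n X\<^esub> \<psi> \<in> locally_zero n X"
    unfolding mult_cochain_group
    by (rule locally_zeroI[OF _ normal_covering_Int[OF U(1) V(1)]])
      (use U(2) V(2) subsetD[OF tuples_normal_covering[OF U(1)]] in \<open>auto simp: tuples_Int\<close>)
qed simp

lemma normal_locally_zero: "locally_zero n X \<lhd> cochain_group n X"
  by (simp add: comm_group.subgroup_imp_normal subgroup_locally_zero)

lemma comm_group_normal_cochain_group [simp]: "comm_group (normal_cochain_group n X)"
  unfolding normal_cochain_group_def
  by (rule comm_group.abelian_FactGroup[OF comm_group_cochain_group subgroup_locally_zero])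

lemma group_normal_cochain_group [simp]: "group (normal_cochain_group n X)"
  using comm_group_normal_cochain_group by (rule comm_group.axioms)

lemma normal_cochain_cases:
  assumes "c \<in> carrier (normal_cochain_group n X)"
  obtains \<phi> where "\<phi> \<in> carrier (cochain_group n X)"
    "c = locally_zero n X #>\<^bsub>cochain_group n X\<^esub> \<phi>"
  using assms by (auto simp: normal_cochain_group_def carrier_FactGroup)

section \<open>The coboundary on the quotients\<close>

lemma coboundary_hom: "coboundary n X \<in> hom (cochain_group n X) (cochain_group (n + 1) X)"
proof (rule homI)
  fix \<phi> \<psi> assume "\<phi> \<in> carrier (cochain_group n X)" "\<psi> \<in> carrier (cochain_group n X)"
  show "coboundary n X (\<phi> \<otimes>\<^bsub>cochain_group n X\<^esub> \<psi>) =
      coboundary n X \<phi> \<otimes>\<^bsub>cochain_group (n + 1) X\<^esub> coboundary n X \<psi>"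
    using tuples_delete[of _ n "topspace X"]
    by (auto simp: coboundary_def mult_cochain_group fun_eq_iff sum.distrib distrib_left
        simp del: sum.lessThan_Suc)
qed (simp add: coboundary_def carrier_cochain_group)

text \<open>Deleting entries keeps a tuple inside the same member, so the covering chosen for
  \<open>\<phi>\<close> also serves for its coboundary.\<close>

lemma coboundary_locally_zero: "coboundary n X ` locally_zero n X \<subseteq> locally_zero (n + 1) X"
proof clarify
  fix \<phi> assume \<phi>: "\<phi> \<in> locally_zero n X"
  obtain \<U> where U: "normal_covering X \<U>" "\<And>U xs. U \<in> \<U> \<Longrightarrow> xs \<in> tuples n U \<Longrightarrow> \<phi> xs = 0"
    using locally_zeroD[OF \<phi>] by blast
  show "coboundary n X \<phi> \<in> locally_zero (n + 1) X"
  proof (rule locally_zeroI[OF _ U(1)])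
    fix U xs assume *: "U \<in> \<U>" "xs \<in> tuples (n + 1) U"
    then show "coboundary n X \<phi> xs = 0"
      using U(2)[OF *(1)] tuples_delete[OF *(2)] tuples_normal_covering[OF U(1) *(1), of "n + 1"]
      by (auto simp: coboundary_def intro!: sum.neutral)
  qed (simp add: coboundary_def)
qed

lemma normal_coboundary_class:
  assumes "\<phi> \<in> carrier (cochain_group n X)"
  shows "normal_coboundary n X (locally_zero n X #>\<^bsub>cochain_group n X\<^esub> \<phi>) =
    locally_zero (n + 1) X #>\<^bsub>cochain_group (n + 1) X\<^esub> coboundary n X \<phi>"
  unfolding normal_coboundary_def
  by (rule coset_map_r_coset[OF _ _ subgroup_locally_zero subgroup_locally_zero coboundary_hom
        coboundary_locally_zero assms]) auto

lemma normal_coboundary_hom: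
  "normal_coboundary n X \<in> hom (normal_cochain_group n X) (normal_cochain_group (n + 1) X)"
  unfolding normal_coboundary_def normal_cochain_group_def
  by (rule coset_map_hom[OF normal_locally_zero normal_locally_zero coboundary_hom
        coboundary_locally_zero])

lemma coboundary_coboundary:
  "coboundary (n + 1) X (coboundary n X \<phi>) = \<one>\<^bsub>cochain_group (n + 2) X\<^esub>"
proof -
  have "(\<Sum>i<length xs. (-1) ^ i * coboundary n X \<phi> (take i xs @ drop (Suc i) xs)) = 0"
    if xs: "xs \<in> tuples (n + 2) (topspace X)" and n: "0 \<le> n" for xs
  proof -
    have "coboundary n X \<phi> (take i xs @ drop (Suc i) xs) = (\<Sum>j<length xs - 1. (-1) ^ j *
        \<phi> (take j (take i xs @ drop (Suc i) xs) @ drop (Suc j) (take i xs @ drop (Suc i) xs)))"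
      if i: "i < length xs" for i
    proof -
      have t: "take i xs @ drop (Suc i) xs \<in> tuples (n + 1) (topspace X)"
        using tuples_delete[of xs "n + 1" "topspace X" i] xs n i by (simp add: add.assoc)
      have l: "length (take i xs @ drop (Suc i) xs) = length xs - 1" using i by auto
      have n': "(n < 0) = False" using n by simp
      show ?thesis by (simp only: coboundary_def restrict_apply t l n' if_True if_False)
    qed
    then have "(\<Sum>i<length xs. (-1) ^ i * coboundary n X \<phi> (take i xs @ drop (Suc i) xs)) =
      (\<Sum>i<length xs. (-1) ^ i * (\<Sum>j<length xs - 1. (-1) ^ j *
        \<phi> (take j (take i xs @ drop (Suc i) xs) @ drop (Suc j) (take i xs @ drop (Suc i) xs))))"
      by (intro sum.cong refl) (simp only: lessThan_iff)
    then show ?thesis by (simp only: alternating_delete_delete_sum)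
  qed
  \<comment> \<open>The hypotheses force \<open>n = -1\<close>, where the inner coboundary is 0 by
    definition. For smaller \<open>n\<close> the outer one is.\<close>
  moreover have "(\<Sum>i<length xs. (-1) ^ i * coboundary n X \<phi> (take i xs @ drop (Suc i) xs)) = 0"
    if "xs \<in> tuples (n + 2) (topspace X)" "n < 0" "0 \<le> n + 1" for xs
    using tuples_delete[of xs "n + 1" "topspace X"] that
    by (intro sum.neutral) (simp add: coboundary_def add.assoc)
  ultimately have "(\<Sum>i<length xs. (-1) ^ i * coboundary n X \<phi> (take i xs @ drop (Suc i) xs)) = 0"
    if "xs \<in> tuples (n + 2) (topspace X)" "0 \<le> n + 1" for xs
    using that by (meson not_less)
  then show ?thesis
    by (auto simp: coboundary_def[of "n + 1"] one_cochain_group fun_eq_iff add.assoc)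
qed

section \<open>Restriction to a subspace\<close>

lemma restrict_cochain_hom:
  "(\<lambda>\<phi>. \<lambda>xs\<in>tuples n (topspace (subtopology X A)). \<phi> (map id xs))
    \<in> hom (cochain_group n X) (cochain_group n (subtopology X A))"
  using tuples_mono[of "topspace X \<inter> A" "topspace X" n]
  by (auto simp: hom_def carrier_cochain_group mult_cochain_group fun_eq_iff)

text \<open>The required covering of the subspace consists of traces. The term
  \<open>map id xs\<close> keeps the shape of \<open>normal_cochain_map\<close> until
  \<open>normal_cochain_map_class\<close> simplifies it.\<close>

lemma restrict_cochain_locally_zero:
  "(\<lambda>\<phi>. \<lambda>xs\<in>tuples n (topspace (subtopology X A)). \<phi> (map id xs)) ` locally_zero n X
    \<subseteq> locally_zero n (subtopology X A)"
proof (rule image_subsetI)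
  fix \<phi> assume \<phi>: "\<phi> \<in> locally_zero n X"
  obtain \<U> where U: "normal_covering X \<U>" "\<And>U xs. U \<in> \<U> \<Longrightarrow> xs \<in> tuples n U \<Longrightarrow> \<phi> xs = 0"
    using locally_zeroD[OF \<phi>] by blast
  note UA = normal_covering_subtopology[OF U(1), of A]
  show "(\<lambda>xs\<in>tuples n (topspace (subtopology X A)). \<phi> (map id xs)) \<in> locally_zero n (subtopology X A)"
    by (rule locally_zeroI[OF _ UA])
      (use U(2) tuples_normal_covering[OF UA, of _ n] in \<open>auto simp: tuples_Int\<close>)
qed

lemma normal_cochain_map_class:
  assumes "\<phi> \<in> carrier (cochain_group n X)"
  shows "normal_cochain_map n (subtopology X A) id (locally_zero n X #>\<^bsub>cochain_group n X\<^esub> \<phi>) =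
    locally_zero n (subtopology X A) #>\<^bsub>cochain_group n (subtopology X A)\<^esub>
      restrict \<phi> (tuples n (topspace (subtopology X A)))"
  unfolding normal_cochain_map_def
  by (subst coset_map_r_coset[OF _ _ subgroup_locally_zero subgroup_locally_zero restrict_cochain_hom
        restrict_cochain_locally_zero assms]) auto

lemma normal_cochain_map_hom:
  "normal_cochain_map n (subtopology X A) id
    \<in> hom (normal_cochain_group n X) (normal_cochain_group n (subtopology X A))"
  unfolding normal_cochain_map_def normal_cochain_group_def
  by (rule coset_map_hom[OF normal_locally_zero normal_locally_zero restrict_cochain_hom
        restrict_cochain_locally_zero])

lemma normal_cochain_map_surj:
  "normal_cochain_map n (subtopology X A) id ` carrier (normal_cochain_group n X)
    = carrier (normal_cochain_group n (subtopology X A))"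
proof (intro subset_antisym subsetI)
  fix c assume "c \<in> carrier (normal_cochain_group n (subtopology X A))"
  then obtain \<psi> where \<psi>: "\<psi> \<in> carrier (cochain_group n (subtopology X A))"
    and c: "c = locally_zero n (subtopology X A) #>\<^bsub>cochain_group n (subtopology X A)\<^esub> \<psi>"
    by (rule normal_cochain_cases)
  \<comment> \<open>Any extension to \<open>X\<close> would do. Off the tuples of the subspace
    \<open>\<psi>\<close> already has the default value \<open>undefined\<close>, and the extension
    keeps it.\<close>
  let ?\<phi> = "restrict \<psi> (tuples n (topspace X))"
  have "?\<phi> \<in> carrier (cochain_group n X)" by (simp add: carrier_cochain_group)
  moreover have "restrict ?\<phi> (tuples n (topspace (subtopology X A))) = \<psi>"
    using \<psi> by (simp add: carrier_cochain_group tuples_Int extensional_restrict)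
  ultimately have "c = normal_cochain_map n (subtopology X A) id (locally_zero n X #>\<^bsub>cochain_group n X\<^esub> ?\<phi>)"
    using c normal_cochain_map_class by metis
  then show "c \<in> normal_cochain_map n (subtopology X A) id ` carrier (normal_cochain_group n X)"
    using \<open>?\<phi> \<in> _\<close> by (auto simp: normal_cochain_group_def carrier_FactGroup)
qed (use hom_in_carrier[OF normal_cochain_map_hom] in auto)

text \<open>This is restriction to \<open>topspace X\<close>. It identifies the effect of j on
  cochains, since j is the identity on points.\<close>

lemma normal_cochain_map_self:
  assumes "c \<in> carrier (normal_cochain_group n X)"
  shows "normal_cochain_map n X id c = c"
proof -
  obtain \<phi> where \<phi>: "\<phi> \<in> carrier (cochain_group n X)"
    and c: "c = locally_zero n X #>\<^bsub>cochain_group n X\<^esub> \<phi>"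
    using assms by (rule normal_cochain_cases)
  have "restrict \<phi> (tuples n (topspace X)) = \<phi>"
    using \<phi> by (simp add: carrier_cochain_group extensional_restrict)
  then show ?thesis
    using normal_cochain_map_class[OF \<phi>, of "topspace X"] c by simp
qed

lemma normal_cochain_map_coboundary:
  assumes "c \<in> carrier (normal_cochain_group n X)"
  shows "normal_cochain_map (n + 1) (subtopology X A) id (normal_coboundary n X c) =
    normal_coboundary n (subtopology X A) (normal_cochain_map n (subtopology X A) id c)"
proof -
  obtain \<phi> where \<phi>: "\<phi> \<in> carrier (cochain_group n X)"
    and c: "c = locally_zero n X #>\<^bsub>cochain_group n X\<^esub> \<phi>"
    using assms by (rule normal_cochain_cases)
  have "restrict \<phi> (tuples n (topspace (subtopology X A))) \<in> carrier (cochain_group n (subtopology X A))"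
    by (simp add: carrier_cochain_group)
  moreover have "restrict (coboundary n X \<phi>) (tuples (n + 1) (topspace (subtopology X A))) =
      coboundary n (subtopology X A) (restrict \<phi> (tuples n (topspace (subtopology X A))))"
    using tuples_delete[of _ n "topspace (subtopology X A)"]
      tuples_mono[of "topspace (subtopology X A)" "topspace X" "n + 1"]
    by (auto simp: coboundary_def fun_eq_iff intro!: sum.cong)
  ultimately show ?thesis
    using \<phi> hom_in_carrier[OF coboundary_hom \<phi>]
    by (simp add: c normal_coboundary_class normal_cochain_map_class)
qed

section \<open>Absolute and relative cochain complexes\<close>

lemma cochain_complex_normal:
  "cochain_complex (\<lambda>n. normal_cochain_group n X) (\<lambda>n. normal_coboundary n X)"
proof (rule cochain_complex.intro)
  fix n c assume "c \<in> carrier (normal_cochain_group n X)"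
  then obtain \<phi> where \<phi>: "\<phi> \<in> carrier (cochain_group n X)"
    and c: "c = locally_zero n X #>\<^bsub>cochain_group n X\<^esub> \<phi>"
    by (rule normal_cochain_cases)
  have "normal_coboundary (n + 1) X (normal_coboundary n X c) =
      locally_zero (n + 1 + 1) X #>\<^bsub>cochain_group (n + 1 + 1) X\<^esub> coboundary (n + 1) X (coboundary n X \<phi>)"
    unfolding c normal_coboundary_class[OF \<phi>]
    by (rule normal_coboundary_class[OF hom_in_carrier[OF coboundary_hom \<phi>]])
  also have "\<dots> = \<one>\<^bsub>normal_cochain_group (n + 2) X\<^esub>"
    using group.coset_join2[OF group_cochain_group _ subgroup_locally_zero, of _ "n + 2" X]
      subgroup.one_closed[OF subgroup_locally_zero, of "n + 2" X]
      monoid.one_closed[OF group.is_monoid[OF group_cochain_group], of "n + 2" X]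
    by (simp add: coboundary_coboundary normal_cochain_group_def add.commute[of n 2])
  finally show "normal_coboundary (n + 1) X (normal_coboundary n X c) = \<one>\<^bsub>normal_cochain_group (n + 2) X\<^esub>" .
qed (auto intro: normal_coboundary_hom)

lemma normal_cochain_map_group_hom:
  "group_hom (normal_cochain_group n X) (normal_cochain_group n (subtopology X A))
    (normal_cochain_map n (subtopology X A) id)"
  by (simp add: group_hom_def group_hom_axioms_def normal_cochain_map_hom)

lemma carrier_rel_normal_cochain_group:
  "carrier (rel_normal_cochain_group X A n) =
    kernel (normal_cochain_group n X) (normal_cochain_group n (subtopology X A))
      (normal_cochain_map n (subtopology X A) id)"
  by (simp add: rel_normal_cochain_group_def)

lemma cochain_complex_rel_normal:
  "cochain_complex (rel_normal_cochain_group X A) (\<lambda>n. normal_coboundary n X)"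
proof -
  interpret N: cochain_complex "\<lambda>n. normal_cochain_group n X" "\<lambda>n. normal_coboundary n X"
    by (rule cochain_complex_normal)
  interpret S: cochain_complex "\<lambda>n. normal_cochain_group n (subtopology X A)"
    "\<lambda>n. normal_coboundary n (subtopology X A)"
    by (rule cochain_complex_normal)
  \<comment> \<open>Restriction commutes with the coboundary, so the coboundary preserves the kernel
    of restriction.\<close>
  have closed: "normal_coboundary n X c \<in> carrier (rel_normal_cochain_group X A (n + 1))"
    if "c \<in> carrier (rel_normal_cochain_group X A n)" for n c
    using that N.\<delta>_closed hom_one[OF S.\<delta>_hom]
    by (auto simp: carrier_rel_normal_cochain_group kernel_def normal_cochain_map_coboundary)
  show ?thesis
  proof (rule cochain_complex.intro)
    show "comm_group (rel_normal_cochain_group X A n)" for n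
      unfolding rel_normal_cochain_group_def
      by (intro comm_group_carrier_update N.comm
          group_hom.subgroup_kernel[OF normal_cochain_map_group_hom])
    show "normal_coboundary n X \<in>
        hom (rel_normal_cochain_group X A n) (rel_normal_cochain_group X A (n + 1))" for n
      using closed[of _ n] hom_mult[OF N.\<delta>_hom[of n]]
      by (intro homI) (auto simp: rel_normal_cochain_group_def kernel_def)
    show "normal_coboundary (n + 1) X (normal_coboundary n X c) = \<one>\<^bsub>rel_normal_cochain_group X A (n + 2)\<^esub>"
      if "c \<in> carrier (rel_normal_cochain_group X A n)" for n c
      using that N.\<delta>_\<delta>[of c n] by (simp add: rel_normal_cochain_group_def kernel_def)
  qed
qed

text \<open>The empty set contains no tuples, so every cochain of the empty space is locally zero.
  Its quotient groups are trivial, and the kernel of restriction to it is everything.\<close>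

lemma rel_normal_cochain_group_empty [simp]:
  "rel_normal_cochain_group X {} = (\<lambda>n. normal_cochain_group n X)"
proof
  fix n
  let ?E = "subtopology X {}"
  have "c = \<one>\<^bsub>normal_cochain_group n ?E\<^esub>" if c: "c \<in> carrier (normal_cochain_group n ?E)" for c
  proof -
    obtain \<phi> where \<phi>: "\<phi> \<in> carrier (cochain_group n ?E)"
      and c: "c = locally_zero n ?E #>\<^bsub>cochain_group n ?E\<^esub> \<phi>"
      using c by (rule normal_cochain_cases)
    have "\<phi> \<in> locally_zero n ?E"
      using \<phi> by (intro locally_zeroI[OF _ normal_covering_topspace]) (auto simp: carrier_cochain_group)
    then show ?thesis
      using group.coset_join2[OF group_cochain_group \<phi> subgroup_locally_zero] c
      by (simp add: normal_cochain_group_def)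
  qed
  then have "kernel (normal_cochain_group n X) (normal_cochain_group n ?E) (normal_cochain_map n ?E id)
      = carrier (normal_cochain_group n X)"
    using hom_in_carrier[OF normal_cochain_map_hom] by (fastforce simp: kernel_def)
  then show "rel_normal_cochain_group X {} n = normal_cochain_group n X"
    by (simp add: rel_normal_cochain_group_def)
qed

section \<open>The sequence of a pair\<close>

lemma normal_chain_map_eq_cone_map:
  "normal_chain_map n X Y B f =
    cone_map (rel_normal_cochain_group Y B) (\<lambda>n. normal_cochain_map n X f) n"
  by (simp add: normal_chain_map_def cone_map_def)

lemma chain_ses_normal_chains:
  assumes "injective_group G'" "injective_group G''" "\<beta> \<in> hom G' G''"
  shows "chain_ses
    (normal_chain_group G' G'' (subtopology X A) {}) (normal_boundary \<beta> G'' (subtopology X A) {})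
    (normal_chain_group G' G'' X {}) (normal_boundary \<beta> G'' X {})
    (normal_chain_group G' G'' X A) (normal_boundary \<beta> G'' X A)
    (\<lambda>n. normal_chain_map n (subtopology X A) X {} id) (\<lambda>n. normal_chain_map n X X A id)"
  unfolding normal_chain_group_def normal_boundary_def normal_chain_map_eq_cone_map
proof (rule chain_ses_cone_map[OF cochain_complex_rel_normal cochain_complex_rel_normal
      cochain_complex_rel_normal _ _ _ _ _ assms])
  fix n
  have sub: "carrier (rel_normal_cochain_group X A n) \<subseteq> carrier (normal_cochain_group n X)"
    by (auto simp: carrier_rel_normal_cochain_group kernel_def)
  then have self: "normal_cochain_map n X id c = c" if "c \<in> carrier (rel_normal_cochain_group X A n)" for c
    using that normal_cochain_map_self by blast
  have closed: "c \<otimes>\<^bsub>normal_cochain_group n X\<^esub> c' \<in> carrier (rel_normal_cochain_group X A n)"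
    if "c \<in> carrier (rel_normal_cochain_group X A n)" "c' \<in> carrier (rel_normal_cochain_group X A n)" for c c'
    using that subgroup.m_closed[OF group_hom.subgroup_kernel[OF normal_cochain_map_group_hom]]
    by (simp add: carrier_rel_normal_cochain_group)
  show "normal_cochain_map n X id \<in> mon (rel_normal_cochain_group X A n) (rel_normal_cochain_group X {} n)"
    using sub self closed
    by (auto simp: mon_def inj_on_def hom_def rel_normal_cochain_group_def[of X A])
  show "normal_cochain_map n (subtopology X A) id
      \<in> epi (rel_normal_cochain_group X {} n) (rel_normal_cochain_group (subtopology X A) {} n)"
    by (simp add: epi_def normal_cochain_map_hom normal_cochain_map_surj)
  \<comment> \<open>As j acts on relative cochains as the identity, exactness at the cochains of
    \<open>X\<close> becomes the definition of the relative group as a kernel.\<close>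
  have "normal_cochain_map n X id ` carrier (rel_normal_cochain_group X A n) =
      carrier (rel_normal_cochain_group X A n)"
    using self by simp
  then show "normal_cochain_map n X id ` carrier (rel_normal_cochain_group X A n) =
      kernel (rel_normal_cochain_group X {} n) (rel_normal_cochain_group (subtopology X A) {} n)
        (normal_cochain_map n (subtopology X A) id)"
    by (simp add: carrier_rel_normal_cochain_group)
  interpret R: cochain_complex "rel_normal_cochain_group X A" "\<lambda>n. normal_coboundary n X"
    by (rule cochain_complex_rel_normal)
  show "normal_cochain_map (n + 1) X id (normal_coboundary n X c) =
      normal_coboundary n X (normal_cochain_map n X id c)"
    if "c \<in> carrier (rel_normal_cochain_group X A n)" for c
    using that self[OF that] R.\<delta>_closed[OF that]
    by (simp add: normal_cochain_map_self carrier_rel_normal_cochain_group kernel_def)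
  show "normal_cochain_map (n + 1) (subtopology X A) id (normal_coboundary n X c) =
      normal_coboundary n (subtopology X A) (normal_cochain_map n (subtopology X A) id c)"
    if "c \<in> carrier (rel_normal_cochain_group X {} n)" for c
    using that by (simp add: normal_cochain_map_coboundary)
qed

text \<open>\<open>exact_seq\<close> lists groups and maps from target to source. Each window
  carries exactness at \<open>X\<close> and at the pair in degree \<open>n\<close> and at the
  subspace in degree \<open>n - 1\<close>; the windows for all integers \<open>n\<close> splice to
  the long sequence.\<close>

theorem corollary5:
  fixes X :: "'a topology" and A :: "'a set"
    and G :: "'g monoid" and G' :: "'d monoid" and G'' :: "'e monoid"
    and \<iota> :: "'g \<Rightarrow> 'd" and \<beta> :: "'d \<Rightarrow> 'e"
  assumes "closed_P_pair X A"
    and "injective_resolution G \<iota> G' \<beta> G''"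
  shows "\<exists>E :: int \<Rightarrow> ('a, 'd, 'e) normal_chain set \<Rightarrow> ('a, 'd, 'e) normal_chain set.
    \<forall>n. exact_seq
      ([normal_homology G' \<beta> G'' (n - 1) X,
        normal_homology G' \<beta> G'' (n - 1) (subtopology X A),
        rel_normal_homology G' \<beta> G'' n X A,
        normal_homology G' \<beta> G'' n X,
        normal_homology G' \<beta> G'' n (subtopology X A)],
       [normal_hom_induced G' \<beta> G'' (n - 1) (subtopology X A) X {} id,
        E n,
        normal_hom_induced G' \<beta> G'' n X X A id,
        normal_hom_induced G' \<beta> G'' n (subtopology X A) X {} id])"
proof -
  have inj: "injective_group G'" "injective_group G''" and \<beta>: "\<beta> \<in> hom G' G''"
    using assms(2) by (auto simp: injective_resolution_def epi_def)
  interpret chain_ses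
    "normal_chain_group G' G'' (subtopology X A) {}" "normal_boundary \<beta> G'' (subtopology X A) {}"
    "normal_chain_group G' G'' X {}" "normal_boundary \<beta> G'' X {}"
    "normal_chain_group G' G'' X A" "normal_boundary \<beta> G'' X A"
    "\<lambda>n. normal_chain_map n (subtopology X A) X {} id" "\<lambda>n. normal_chain_map n X X A id"
    by (rule chain_ses_normal_chains[OF inj \<beta>])
  \<comment> \<open>Once unfolded, the groups and induced maps are literally
    \<open>chain_homology\<close> and \<open>induced\<close> of the interpreted complexes, so the
    facts of the locale apply as they stand.\<close>
  show ?thesis
    unfolding rel_normal_homology_def normal_hom_induced_def
  proof (intro exI[of _ connecting] allI, goal_cases)
    case (1 n)
    show ?case
      using F.induced_hom[of n] F.induced_hom[of "n - 1"] G.induced_hom[of n] connecting_hom[of n]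
        exact_at_left[of n] exact_at_middle[of n] exact_at_right[of n]
      by (auto simp: group_hom_def group_hom_axioms_def)
  qed
qed

end
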